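(* If $X$ and $Y$ are nonseparable Banach spaces belonging to the class $\mathcal E$, then the $\ell_1$-sum $X\oplus_{\ell_1}Y$ belongs to $\mathcal E$.
   Context: Compact spaces are Hausdorff. For a compact space $K$, $\mathcal Q(K)$ is the set of all Hausdorff quotient spaces $L=K/E$ ($E$ an equivalence relation on $K$, quotient topology), each with its canonical projection $p_L:K\to L$. It is ordered by: $L\le L'$ iff there is a continuous surjection $q:L'\to L$ (the natural projection) with $q\,p_{L'}=p_L$; equivalently, the equivalence relation of $L'$ is contained in that of $L$. Suprema in $\mathcal Q(K)$ correspond to intersections of equivalence relations. $\mathcal Q_\omega(K)\subset\mathcal Q(K)$ is the set of quotients of countable weight. A family $\mathcal S\subset\mathcal Q_\omega(K)$ is cofinal if for every $L\in\mathcal Q_\omega(K)$ there is $L'\in\mathcal S$ with $L\le L'$; it is a $\sigma$-semilattice if the supremum of every countable subset of $\mathcal S$ belongs to $\mathcal S$. Given a continuous surjection $\pi:M\to N$, a sequence $(x_n)$ in $N$ converging to $x\in N$ is called $\pi$-fiber convergent if for every $y\in\pi^{-1}(x)$ there are $y_n\in\pi^{-1}(x_n)$ with $y_n\to y$. If $K$ is a compact space of uncountable weight and $(x_n)$ is a sequence in $K$ converging to $x\in K$, then $(x_n)$ is called fiber convergent if there is a cofinal $\sigma$-semilattice $\mathcal S\subset\mathcal Q_\omega(K)$ such that for all $L'\le L$ in $\mathcal S$, with natural projection $\pi:L\to L'$, the sequence $(p_{L'}(x_n))_n$ (which converges to $p_{L'}(x)$) is $\pi$-fiber convergent. A nonseparable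 Banach space $X$ belongs to the class $\mathcal E$ if the fiber convergent sequences of $(B_{X^\ast},w^\ast)$ are exactly the norm convergent sequences of $B_{X^\ast}$. Here $B_{X^\ast}$ is the closed unit ball of the dual $X^\ast$. $X\oplus_{\ell_1}Y$ is the direct sum with norm $\|x\|+\|y\|$. *)

theory Defs
  imports "HOL-Analysis.Analysis"
begin

section \<open>Hausdorff quotients of a space\<close>

text \<open>A quotient \<open>L = K/E\<close> is represented by the equivalence relation \<open>E\<close> on \<open>topspace K\<close>; its points
  are the equivalence classes and its canonical projection is \<open>\<lambda>x. E `` {x}\<close>.\<close>

definition quotient_space :: "'a topology \<Rightarrow> ('a \<times> 'a) set \<Rightarrow> 'a set topology" where
  "quotient_space K E =
     topology (\<lambda>U. U \<subseteq> topspace K // E \<and> openin K {x \<in> topspace K. E `` {x} \<in> U})"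

lemma openin_quotient_space:
  "openin (quotient_space K E) U \<longleftrightarrow>
     U \<subseteq> topspace K // E \<and> openin K {x \<in> topspace K. E `` {x} \<in> U}"
proof -
  have "istopology (\<lambda>U. U \<subseteq> topspace K // E \<and> openin K {x \<in> topspace K. E `` {x} \<in> U})"
    unfolding istopology_def
  proof (intro conjI allI impI)
    fix S T
    assume S: "S \<subseteq> topspace K // E \<and> openin K {x \<in> topspace K. E `` {x} \<in> S}"
      and T: "T \<subseteq> topspace K // E \<and> openin K {x \<in> topspace K. E `` {x} \<in> T}"
    have "{x \<in> topspace K. E `` {x} \<in> S \<inter> T} =
        {x \<in> topspace K. E `` {x} \<in> S} \<inter> {x \<in> topspace K. E `` {x} \<in> T}"
      by blast
    with S T show "openin K {x \<in> topspace K. E `` {x} \<in> S \<inter> T}"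
      by (simp add: openin_Int)
    from S show "S \<inter> T \<subseteq> topspace K // E" by blast
  next
    fix \<K>
    assume *: "\<forall>S\<in>\<K>. S \<subseteq> topspace K // E \<and> openin K {x \<in> topspace K. E `` {x} \<in> S}"
    have "{x \<in> topspace K. E `` {x} \<in> \<Union>\<K>} = (\<Union>S\<in>\<K>. {x \<in> topspace K. E `` {x} \<in> S})"
      by blast
    with * show "openin K {x \<in> topspace K. E `` {x} \<in> \<Union>\<K>}"
      by auto
    from * show "\<Union>\<K> \<subseteq> topspace K // E" by blast
  qed
  then show ?thesis
    unfolding quotient_space_def by (simp add: topology_inverse')
qed

lemma topspace_quotient_space [simp]: "topspace (quotient_space K E) = topspace K // E"
proof -
  have "{x \<in> topspace K. E `` {x} \<in> topspace K // E} = topspace K"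
    by (auto intro: quotientI)
  then have "openin (quotient_space K E) (topspace K // E)"
    by (simp add: openin_quotient_space)
  then show ?thesis
    by (metis openin_quotient_space openin_subset openin_topspace subset_antisym)
qed

lemma quotient_map_quotient_space: "quotient_map K (quotient_space K E) (\<lambda>x. E `` {x})"
  by (auto simp: quotient_map_def openin_quotient_space quotient_def)

definition hausdorff_quotients :: "'a topology \<Rightarrow> ('a \<times> 'a) set set" where
  "hausdorff_quotients K = {E. equiv (topspace K) E \<and> Hausdorff_space (quotient_space K E)}"

definition countable_weight_quotients :: "'a topology \<Rightarrow> ('a \<times> 'a) set set" where
  "countable_weight_quotients K =
     {E \<in> hausdorff_quotients K. second_countable (quotient_space K E)}"

text \<open>\<open>q\<close> is the natural projection from \<open>K/E\<close> onto \<open>K/E'\<close>.\<close>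

definition natural_projection ::
    "'a topology \<Rightarrow> ('a \<times> 'a) set \<Rightarrow> ('a \<times> 'a) set \<Rightarrow> ('a set \<Rightarrow> 'a set) \<Rightarrow> bool" where
  "natural_projection K E E' q \<longleftrightarrow>
     continuous_map (quotient_space K E) (quotient_space K E') q \<and>
     q ` topspace (quotient_space K E) = topspace (quotient_space K E') \<and>
     (\<forall>x\<in>topspace K. q (E `` {x}) = E' `` {x})"

definition quotient_le :: "'a topology \<Rightarrow> ('a \<times> 'a) set \<Rightarrow> ('a \<times> 'a) set \<Rightarrow> bool" where
  "quotient_le K E' E \<longleftrightarrow> (\<exists>q. natural_projection K E E' q)"

lemma quotient_le_iff_supset:
  assumes E: "equiv (topspace K) E" and E': "equiv (topspace K) E'"
  shows "quotient_le K E' E \<longleftrightarrow> E \<subseteq> E'"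
proof
  assume "quotient_le K E' E"
  then obtain q where "natural_projection K E E' q"
    unfolding quotient_le_def ..
  then have q: "\<And>x. x \<in> topspace K \<Longrightarrow> q (E `` {x}) = E' `` {x}"
    unfolding natural_projection_def by simp
  show "E \<subseteq> E'"
  proof (rule subrelI)
    fix x y assume xy: "(x, y) \<in> E"
    then have x: "x \<in> topspace K" and y: "y \<in> topspace K" and eq: "E `` {x} = E `` {y}"
      using E equiv_class_eq_iff[of "topspace K" E x y] by simp_all
    have "E' `` {x} = E' `` {y}"
      using q[OF x] q[OF y] eq by simp
    then show "(x, y) \<in> E'"
      using E' x y by (simp add: eq_equiv_class_iff)
  qed
next
  assume sub: "E \<subseteq> E'"
  define q where "q C = E' `` C" for C
  have q: "q (E `` {x}) = E' `` {x}" if "x \<in> topspace K" for x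
  proof -
    have "E' `` {y} = E' `` {x}" if "y \<in> E `` {x}" for y
      using that sub equiv_class_eq[OF E', of x y] by auto
    moreover have "x \<in> E `` {x}"
      using equiv_class_self[OF E that] .
    ultimately show ?thesis
      unfolding q_def by blast
  qed
  have "continuous_map K (quotient_space K E') (q \<circ> (\<lambda>x. E `` {x}))"
    using quotient_imp_continuous_map[OF quotient_map_quotient_space, of K E']
    by (rule continuous_map_eq) (simp add: q)
  then have "continuous_map (quotient_space K E) (quotient_space K E') q"
    using quotient_map_quotient_space continuous_compose_quotient_map by blast
  moreover have "q ` (topspace K // E) = topspace K // E'"
    using q by (simp add: quotient_def image_UN)
  ultimately show "quotient_le K E' E"
    unfolding quotient_le_def natural_projection_def using q by auto
qed

definition is_quotient_sup ::
    "'a topology \<Rightarrow> ('a \<times> 'a) set set \<Rightarrow> ('a \<times> 'a) set \<Rightarrow> bool" where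
  "is_quotient_sup K \<A> E \<longleftrightarrow>
     E \<in> hausdorff_quotients K \<and> (\<forall>A\<in>\<A>. quotient_le K A E) \<and>
     (\<forall>F\<in>hausdorff_quotients K. (\<forall>A\<in>\<A>. quotient_le K A F) \<longrightarrow> quotient_le K E F)"

definition cofinal_quotients :: "'a topology \<Rightarrow> ('a \<times> 'a) set set \<Rightarrow> bool" where
  "cofinal_quotients K \<S> \<longleftrightarrow>
     \<S> \<subseteq> countable_weight_quotients K \<and>
     (\<forall>E\<in>countable_weight_quotients K. \<exists>F\<in>\<S>. quotient_le K E F)"

definition sigma_semilattice :: "'a topology \<Rightarrow> ('a \<times> 'a) set set \<Rightarrow> bool" where
  "sigma_semilattice K \<S> \<longleftrightarrow>
     \<S> \<subseteq> countable_weight_quotients K \<and>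
     (\<forall>\<A>. \<A> \<subseteq> \<S> \<and> countable \<A> \<longrightarrow> (\<exists>E\<in>\<S>. is_quotient_sup K \<A> E))"


section \<open>Fiber convergence\<close>

definition map_fiber_convergent ::
    "'a topology \<Rightarrow> 'b topology \<Rightarrow> ('a \<Rightarrow> 'b) \<Rightarrow> (nat \<Rightarrow> 'b) \<Rightarrow> 'b \<Rightarrow> bool" where
  "map_fiber_convergent M N \<pi> xs x \<longleftrightarrow>
     continuous_map M N \<pi> \<and> \<pi> ` topspace M = topspace N \<and>
     range xs \<subseteq> topspace N \<and> limitin N xs x sequentially \<and>
     (\<forall>y\<in>topspace M. \<pi> y = x \<longrightarrow>
        (\<exists>ys. (\<forall>n. ys n \<in> topspace M \<and> \<pi> (ys n) = xs n) \<and> limitin M ys y sequentially))"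

definition fiber_convergent_to :: "'a topology \<Rightarrow> (nat \<Rightarrow> 'a) \<Rightarrow> 'a \<Rightarrow> bool" where
  "fiber_convergent_to K xs x \<longleftrightarrow>
     compact_space K \<and> Hausdorff_space K \<and> \<not> second_countable K \<and>
     range xs \<subseteq> topspace K \<and> limitin K xs x sequentially \<and>
     (\<exists>\<S>. cofinal_quotients K \<S> \<and> sigma_semilattice K \<S> \<and>
        (\<forall>E\<in>\<S>. \<forall>E'\<in>\<S>. \<forall>\<pi>. natural_projection K E E' \<pi> \<longrightarrow>
           map_fiber_convergent (quotient_space K E) (quotient_space K E') \<pi>
             (\<lambda>n. E' `` {xs n}) (E' `` {x})))"

definition fiber_convergent :: "'a topology \<Rightarrow> (nat \<Rightarrow> 'a) \<Rightarrow> bool" where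
  "fiber_convergent K xs \<longleftrightarrow> (\<exists>x. fiber_convergent_to K xs x)"


section \<open>The class \<open>\<E>\<close>\<close>

text \<open>On the dual space \<open>'a \<Rightarrow>\<^sub>L real\<close>, the strong operator topology (pointwise convergence on \<open>'a\<close>)
  is the weak-star topology.\<close>

definition dual_ball :: "('a::real_normed_vector \<Rightarrow>\<^sub>L real) topology" where
  "dual_ball = subtopology strong_operator_topology (cball 0 1)"

definition class_E :: "'a::banach itself \<Rightarrow> bool" where
  "class_E _ \<longleftrightarrow>
     \<not> separable_space (euclidean :: 'a topology) \<and>
     (\<forall>xs :: nat \<Rightarrow> 'a \<Rightarrow>\<^sub>L real. range xs \<subseteq> cball 0 1 \<longrightarrow>
        (fiber_convergent dual_ball xs \<longleftrightarrow> convergent xs))"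


section \<open>The \<open>\<ell>\<^sub>1\<close>-sum of two Banach spaces\<close>

text \<open>The product type already carries the Euclidean norm, hence a separate type.\<close>

datatype ('a, 'b) l1_sum = L1_Pair (l1_fst: 'a) (l1_snd: 'b)

instantiation l1_sum :: (real_normed_vector, real_normed_vector) real_normed_vector
begin

definition "0 = L1_Pair 0 0"
definition "x + y = L1_Pair (l1_fst x + l1_fst y) (l1_snd x + l1_snd y)"
definition "x - y = L1_Pair (l1_fst x - l1_fst y) (l1_snd x - l1_snd y)"
definition "- x = L1_Pair (- l1_fst x) (- l1_snd x)"
definition "r *\<^sub>R x = L1_Pair (r *\<^sub>R l1_fst x) (r *\<^sub>R l1_snd x)"
definition norm_l1_sum_def: "norm x = norm (l1_fst x) + norm (l1_snd x)"
definition dist_l1_sum_def: "dist x y = norm (x - y :: ('a, 'b) l1_sum)"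
definition sgn_l1_sum_def: "sgn x = inverse (norm x) *\<^sub>R (x :: ('a, 'b) l1_sum)"
definition uniformity_l1_sum_def:
  "(uniformity :: (('a, 'b) l1_sum \<times> ('a, 'b) l1_sum) filter) =
     (INF e\<in>{0<..}. principal {(x, y). dist x y < e})"
definition open_l1_sum_def:
  "open (U :: ('a, 'b) l1_sum set) \<longleftrightarrow>
     (\<forall>x\<in>U. eventually (\<lambda>(x', y). x' = x \<longrightarrow> y \<in> U) uniformity)"

lemmas l1_sum_vector_defs =
  zero_l1_sum_def plus_l1_sum_def minus_l1_sum_def uminus_l1_sum_def scaleR_l1_sum_def

instance
proof
  fix x y z :: "('a, 'b) l1_sum" and r s :: real
  show "norm (x + y) \<le> norm x + norm y"
    using norm_triangle_ineq[of "l1_fst x" "l1_fst y"] norm_triangle_ineq[of "l1_snd x" "l1_snd y"]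
    by (simp add: norm_l1_sum_def l1_sum_vector_defs)
  show "norm x = 0 \<longleftrightarrow> x = 0"
    by (cases x) (simp add: norm_l1_sum_def l1_sum_vector_defs add_nonneg_eq_0_iff)
qed (simp_all add: l1_sum_vector_defs l1_sum.expand algebra_simps dist_l1_sum_def sgn_l1_sum_def
      norm_l1_sum_def uniformity_l1_sum_def open_l1_sum_def)

end

lemma l1_sum_sel_simps [simp]:
  "l1_fst 0 = 0" "l1_snd 0 = 0"
  "l1_fst (x + y) = l1_fst x + l1_fst y" "l1_snd (x + y) = l1_snd x + l1_snd y"
  "l1_fst (x - y) = l1_fst x - l1_fst y" "l1_snd (x - y) = l1_snd x - l1_snd y"
  "l1_fst (- x) = - l1_fst x" "l1_snd (- x) = - l1_snd x"
  "l1_fst (r *\<^sub>R x) = r *\<^sub>R l1_fst x" "l1_snd (r *\<^sub>R x) = r *\<^sub>R l1_snd x"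
  by (simp_all add: l1_sum_vector_defs)

instance l1_sum :: (banach, banach) banach
proof
  fix X :: "nat \<Rightarrow> ('a, 'b) l1_sum"
  assume X: "Cauchy X"
  have le: "dist (l1_fst x) (l1_fst y) \<le> dist x y" "dist (l1_snd x) (l1_snd y) \<le> dist x y"
    for x y :: "('a, 'b) l1_sum"
    by (simp_all add: dist_l1_sum_def norm_l1_sum_def dist_norm)
  have "Cauchy (\<lambda>n. l1_fst (X n))" "Cauchy (\<lambda>n. l1_snd (X n))"
    using X le unfolding Cauchy_def by (meson order_le_less_trans)+
  then obtain a b where
    a: "(\<lambda>n. l1_fst (X n)) \<longlonglongrightarrow> a" and b: "(\<lambda>n. l1_snd (X n)) \<longlonglongrightarrow> b"
    by (meson Cauchy_convergent convergent_def)
  have "(\<lambda>n. norm (l1_fst (X n) - a) + norm (l1_snd (X n) - b)) \<longlonglongrightarrow> 0 + 0"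
    using a b by (intro tendsto_add) (simp_all add: LIM_zero tendsto_norm_zero)
  then have "X \<longlonglongrightarrow> L1_Pair a b"
    by (subst tendsto_dist_iff) (simp add: dist_l1_sum_def norm_l1_sum_def)
  then show "convergent X"
    by (rule convergentI)
qed

end

theory Submission
  imports Defs
begin

text \<open>The dual ball of the \<open>\<ell>\<^sub>1\<close>-sum of \<open>X\<close> and \<open>Y\<close> is \<open>K \<times> L\<close>, where \<open>K\<close> and \<open>L\<close> are the dual balls of \<open>X\<close> and \<open>Y\<close>, and
  norm convergence in it is coordinatewise; so it suffices that fiber convergence in \<open>K \<times> L\<close> is coordinatewise.
  Every quotient of countable weight of \<open>K \<times> L\<close> lies below one of the form \<open>K/E \<times> L/F\<close>. Hence the
  products of two cofinal \<open>\<sigma>\<close>-semilattices form a cofinal \<open>\<sigma>\<close>-semilattice, and fibers of the natural projections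
  are products of fibers. Conversely, a closing-off argument shows that the members of the form \<open>E \<times> F\<close> of a
  cofinal \<open>\<sigma>\<close>-semilattice for \<open>K \<times> L\<close> are still cofinal, and their first components witness fiber
  convergence in \<open>K\<close>.\<close>

section \<open>Quotients as kernels of continuous maps\<close>

lemma compact_space_quotient_space:
  assumes "compact_space X"
  shows "compact_space (quotient_space X E)"
  using image_compactin[OF assms[unfolded compact_space_def]
      quotient_imp_continuous_map[OF quotient_map_quotient_space[of X E]]]
    quotient_imp_surjective_map[OF quotient_map_quotient_space[of X E]]
  by (simp add: compact_space_def)

definition map_kernel :: "'a topology \<Rightarrow> ('a \<Rightarrow> 'b) \<Rightarrow> ('a \<times> 'a) set" where
  "map_kernel X f = {(x, y). x \<in> topspace X \<and> y \<in> topspace X \<and> f x = f y}"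

lemma equiv_map_kernel: "equiv (topspace X) (map_kernel X f)"
  by (rule equivI) (auto simp: map_kernel_def refl_on_def sym_def trans_def)

text \<open>The map that \<open>f\<close> induces on classes is a continuous bijection from a
  compact space onto a Hausdorff subspace of \<open>Y\<close>, hence a homeomorphism onto the image.
  Weight, separation and limits in the quotient can therefore be read off in
  \<open>Y\<close>.\<close>

lemma quotient_space_map_kernel:
  assumes X: "compact_space X" and Y: "Hausdorff_space Y" and f: "continuous_map X Y f"
  obtains g where
    "homeomorphic_map (quotient_space X (map_kernel X f)) (subtopology Y (f ` topspace X)) g"
    "\<And>x. x \<in> topspace X \<Longrightarrow> g (map_kernel X f `` {x}) = f x"
proof -
  let ?E = "map_kernel X f" and ?Z = "subtopology Y (f ` topspace X)"
  define g where "g C = f (SOME x. x \<in> C)" for C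
  have g: "g (?E `` {x}) = f x" if "x \<in> topspace X" for x
  proof -
    have "x \<in> ?E `` {x}" using that by (auto simp: map_kernel_def)
    then have "(SOME y. y \<in> ?E `` {x}) \<in> ?E `` {x}" by (rule someI)
    then show ?thesis unfolding g_def by (auto simp: map_kernel_def)
  qed
  have "continuous_map X ?Z f"
    using f by (auto simp: continuous_map_in_subtopology)
  then have "continuous_map X ?Z (g \<circ> (\<lambda>x. ?E `` {x}))"
    by (rule continuous_map_eq) (simp add: g)
  then have cont: "continuous_map (quotient_space X ?E) ?Z g"
    using quotient_map_quotient_space continuous_compose_quotient_map by blast
  have "compact_space (quotient_space X ?E)"
    by (rule compact_space_quotient_space[OF X])
  moreover have "Hausdorff_space ?Z"
    using Y by (rule Hausdorff_space_subtopology)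
  moreover have "g ` topspace (quotient_space X ?E) = topspace ?Z"
    using f[THEN continuous_map_image_subset_topspace]
    by (auto simp: quotient_def image_UN g)
  moreover have "inj_on g (topspace (quotient_space X ?E))"
  proof (rule inj_onI)
    fix C D assume "C \<in> topspace (quotient_space X ?E)" "D \<in> topspace (quotient_space X ?E)" "g C = g D"
    then obtain x y where "x \<in> topspace X" "y \<in> topspace X" "C = ?E `` {x}" "D = ?E `` {y}"
      by (auto simp: quotient_def)
    moreover from this have "f x = f y" using \<open>g C = g D\<close> by (simp add: g)
    ultimately show "C = D" by (simp add: map_kernel_def)
  qed
  ultimately have "homeomorphic_map (quotient_space X ?E) ?Z g"
    using cont continuous_imp_homeomorphic_map by blast
  then show thesis using g that by blast
qed

lemma second_countable_homeomorphic_map: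
  assumes "homeomorphic_map X Y g" "second_countable Y"
  shows "second_countable X"
proof -
  obtain h where "homeomorphic_map Y X h"
    using assms(1) homeomorphic_map_maps homeomorphic_maps_sym by metis
  then show ?thesis
    using assms(2) second_countable_open_map_image homeomorphic_eq_everything_map by metis
qed

lemma map_kernel_in_hausdorff_quotients:
  assumes X: "compact_space X" and Y: "Hausdorff_space Y" and f: "continuous_map X Y f"
  shows "map_kernel X f \<in> hausdorff_quotients X"
proof -
  obtain g where "homeomorphic_map (quotient_space X (map_kernel X f)) (subtopology Y (f ` topspace X)) g"
    using quotient_space_map_kernel[OF assms] by metis
  then have "Hausdorff_space (quotient_space X (map_kernel X f))"
    using Y Hausdorff_space_subtopology homeomorphic_Hausdorff_space
      homeomorphic_map_imp_homeomorphic_space by metis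
  then show ?thesis by (simp add: hausdorff_quotients_def equiv_map_kernel)
qed

lemma map_kernel_in_countable_weight_quotients:
  assumes X: "compact_space X" and Y: "Hausdorff_space Y" and f: "continuous_map X Y f"
    and "second_countable Y"
  shows "map_kernel X f \<in> countable_weight_quotients X"
proof -
  obtain g where "homeomorphic_map (quotient_space X (map_kernel X f)) (subtopology Y (f ` topspace X)) g"
    using quotient_space_map_kernel[OF X Y f] by metis
  then have "second_countable (quotient_space X (map_kernel X f))"
    using assms(4) second_countable_subtopology second_countable_homeomorphic_map by metis
  then show ?thesis
    using map_kernel_in_hausdorff_quotients[OF X Y f] by (simp add: countable_weight_quotients_def)
qed

text \<open>Convergence in \<open>K/E\<close> is phrased with points of \<open>K\<close>, so that
  later arguments can work with representatives instead of classes.\<close>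

definition quotient_limit ::
    "'a topology \<Rightarrow> ('a \<times> 'a) set \<Rightarrow> (nat \<Rightarrow> 'a) \<Rightarrow> 'a \<Rightarrow> bool" where
  "quotient_limit K E xs x \<longleftrightarrow> limitin (quotient_space K E) (\<lambda>n. E `` {xs n}) (E `` {x}) sequentially"

text \<open>The homeomorphism between the quotient and the image of \<open>f\<close> carries limits
  in both directions.\<close>

lemma quotient_limit_map_kernel:
  assumes X: "compact_space X" and Y: "Hausdorff_space Y" and f: "continuous_map X Y f"
    and xs: "range xs \<subseteq> topspace X" and x: "x \<in> topspace X"
  shows "quotient_limit X (map_kernel X f) xs x \<longleftrightarrow> limitin Y (\<lambda>n. f (xs n)) (f x) sequentially"
proof -
  let ?E = "map_kernel X f" and ?Z = "subtopology Y (f ` topspace X)"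
  obtain g where g: "homeomorphic_map (quotient_space X ?E) ?Z g"
    and gx: "\<And>x. x \<in> topspace X \<Longrightarrow> g (?E `` {x}) = f x"
    using quotient_space_map_kernel[OF X Y f] by metis
  obtain h where h: "homeomorphic_maps (quotient_space X ?E) ?Z g h"
    using g homeomorphic_map_maps by blast
  have cg: "continuous_map (quotient_space X ?E) ?Z g"
    and ch: "continuous_map ?Z (quotient_space X ?E) h"
    and hg: "\<And>C. C \<in> topspace X // ?E \<Longrightarrow> h (g C) = C"
    using h by (auto simp: homeomorphic_maps_def)
  have hx: "h (f x) = ?E `` {x}" if "x \<in> topspace X" for x
    using hg[of "?E `` {x}"] gx[OF that] that by (simp add: quotientI)
  have xs': "xs n \<in> topspace X" for n using xs by auto
  have "quotient_limit X ?E xs x \<longleftrightarrow> limitin ?Z (\<lambda>n. f (xs n)) (f x) sequentially"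
  proof
    assume "quotient_limit X ?E xs x"
    from continuous_map_limit[OF cg this[unfolded quotient_limit_def]]
    show "limitin ?Z (\<lambda>n. f (xs n)) (f x) sequentially"
      by (simp add: o_def gx xs' x)
  next
    assume "limitin ?Z (\<lambda>n. f (xs n)) (f x) sequentially"
    from continuous_map_limit[OF ch this]
    show "quotient_limit X ?E xs x"
      by (simp add: o_def hx xs' x quotient_limit_def)
  qed
  then show ?thesis using xs' x by (simp add: limitin_subtopology)
qed

text \<open>The intersection is the kernel of the diagonal map into the product of the quotients
  \<open>X/E\<close> with \<open>E\<close> in \<open>\<A>\<close>, and that product is Hausdorff.
  For the empty family the diagonal map is constant, which gives the full square.\<close>

lemma Inter_in_hausdorff_quotients:
  assumes X: "compact_space X" and A: "\<A> \<subseteq> hausdorff_quotients X"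
  shows "topspace X \<times> topspace X \<inter> \<Inter>\<A> \<in> hausdorff_quotients X"
proof -
  let ?f = "\<lambda>x. \<lambda>E\<in>\<A>. E `` {x}"
  have "Hausdorff_space (product_topology (quotient_space X) \<A>)"
    using A by (auto simp: Hausdorff_space_product_topology hausdorff_quotients_def)
  moreover have "continuous_map X (product_topology (quotient_space X) \<A>) ?f"
    by (auto simp: continuous_map_componentwise quotient_imp_continuous_map[OF quotient_map_quotient_space])
  ultimately have "map_kernel X ?f \<in> hausdorff_quotients X"
    by (rule map_kernel_in_hausdorff_quotients[OF X])
  moreover have "map_kernel X ?f = topspace X \<times> topspace X \<inter> \<Inter>\<A>"
  proof -
    have "?f x = ?f y \<longleftrightarrow> (\<forall>E\<in>\<A>. (x, y) \<in> E)" if xy: "x \<in> topspace X" "y \<in> topspace X" for x y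
    proof -
      have "?f x = ?f y \<longleftrightarrow> (\<forall>E\<in>\<A>. E `` {x} = E `` {y})"
        by (metis (no_types, lifting) restrict_apply restrict_ext)
      moreover have "E `` {x} = E `` {y} \<longleftrightarrow> (x, y) \<in> E" if "E \<in> \<A>" for E
        using A that xy eq_equiv_class_iff[of "topspace X" E x y] by (auto simp: hausdorff_quotients_def)
      ultimately show ?thesis by simp
    qed
    then show ?thesis by (auto simp: map_kernel_def)
  qed
  ultimately show ?thesis by simp
qed

text \<open>The factor \<open>topspace X \<times> topspace X\<close> matters only for \<open>\<A> = {}\<close>, where \<open>\<Inter>\<A>\<close> is \<open>UNIV\<close>.\<close>

lemma is_quotient_sup_iff:
  assumes X: "compact_space X" and A: "\<A> \<subseteq> hausdorff_quotients X"
  shows "is_quotient_sup X \<A> E \<longleftrightarrow> E = topspace X \<times> topspace X \<inter> \<Inter>\<A>"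
proof -
  let ?I = "topspace X \<times> topspace X \<inter> \<Inter>\<A>"
  have I: "?I \<in> hausdorff_quotients X" by (rule Inter_in_hausdorff_quotients[OF assms])
  have le: "quotient_le X E F \<longleftrightarrow> F \<subseteq> E"
    if "E \<in> hausdorff_quotients X" "F \<in> hausdorff_quotients X" for E F
    using that quotient_le_iff_supset by (auto simp: hausdorff_quotients_def)
  have sub: "F \<subseteq> topspace X \<times> topspace X" if "F \<in> hausdorff_quotients X" for F
    using that by (auto simp: hausdorff_quotients_def equiv_def refl_on_def)
  have all: "(\<forall>A\<in>\<A>. quotient_le X A F) \<longleftrightarrow> (\<forall>A\<in>\<A>. F \<subseteq> A)" if "F \<in> hausdorff_quotients X" for F
    by (rule ball_cong[OF refl]) (use le[OF _ that] A in blast)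
  show ?thesis
  proof
    assume L: "is_quotient_sup X \<A> E"
    then have E: "E \<in> hausdorff_quotients X" by (simp add: is_quotient_sup_def)
    \<comment> \<open>\<open>?I\<close> is a Hausdorff quotient above all of \<open>\<A>\<close>, so
      the supremum lies below it; for the relations this is the inclusion
      \<open>?I \<subseteq> E\<close>.\<close>
    have "\<forall>A\<in>\<A>. quotient_le X A ?I" using all[OF I] by blast
    then have "quotient_le X E ?I" using L I unfolding is_quotient_sup_def by blast
    then have "?I \<subseteq> E" using le[OF E I] by simp
    moreover have "E \<subseteq> ?I" using L E sub[OF E] all[OF E] unfolding is_quotient_sup_def by blast
    ultimately show "E = ?I" by blast
  next
    assume eq: "E = ?I"
    have "quotient_le X ?I F" if F: "F \<in> hausdorff_quotients X" "\<forall>A\<in>\<A>. quotient_le X A F" for F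
      using F sub[OF F(1)] all[OF F(1)] le[OF I F(1)] by blast
    moreover have "\<forall>A\<in>\<A>. quotient_le X A ?I" using all[OF I] by blast
    ultimately show "is_quotient_sup X \<A> E"
      unfolding is_quotient_sup_def eq using I by blast
  qed
qed

section \<open>Fiber convergence in terms of equivalence relations\<close>

text \<open>Fiber convergence along the projection from \<open>K/E\<close> to \<open>K/E'\<close>:
  \<open>y\<close> runs through representatives of the points over the class of \<open>x\<close>,
  and \<open>ys\<close> represents a lift of the sequence.\<close>

definition relation_fiber_convergent ::
    "'a topology \<Rightarrow> (nat \<Rightarrow> 'a) \<Rightarrow> 'a \<Rightarrow> ('a \<times> 'a) set \<Rightarrow> ('a \<times> 'a) set \<Rightarrow> bool" where
  "relation_fiber_convergent K xs x E E' \<longleftrightarrow>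
     (\<forall>y. (y, x) \<in> E' \<longrightarrow> (\<exists>ys. (\<forall>n. (ys n, xs n) \<in> E') \<and> quotient_limit K E ys y))"

text \<open>The fiber over the \<open>E'\<close>-class of \<open>x\<close> consists of the
  \<open>E\<close>-classes of the points \<open>E'\<close>-related to \<open>x\<close>, so a lift in
  \<open>K/E\<close> can be replaced by a sequence of representatives. The limit in
  \<open>K/E'\<close> comes from continuity of the canonical projection.\<close>

lemma map_fiber_convergent_natural_projection:
  assumes \<pi>: "natural_projection K E E' \<pi>" and E: "equiv (topspace K) E" and E': "equiv (topspace K) E'"
    and xs: "range xs \<subseteq> topspace K" and lim: "limitin K xs x sequentially"
  shows "map_fiber_convergent (quotient_space K E) (quotient_space K E') \<pi>
      (\<lambda>n. E' `` {xs n}) (E' `` {x}) \<longleftrightarrow> relation_fiber_convergent K xs x E E'"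
proof -
  have x: "x \<in> topspace K" using lim by (rule limitin_topspace)
  have xs': "xs n \<in> topspace K" for n using xs by auto
  have lim': "limitin (quotient_space K E') (\<lambda>n. E' `` {xs n}) (E' `` {x}) sequentially"
    using continuous_map_limit[OF quotient_imp_continuous_map[OF quotient_map_quotient_space] lim]
    by (simp add: o_def)
  have p: "\<pi> (E `` {y}) = E' `` {x} \<longleftrightarrow> (y, x) \<in> E'" if "y \<in> topspace K" "x \<in> topspace K" for x y
    using \<pi> that eq_equiv_class_iff[OF E'] by (auto simp: natural_projection_def)
  have top: "y \<in> topspace K" if "(y, x) \<in> E'" for x y
    using that E' by (auto simp: equiv_def refl_on_def)
  have lift: "(\<exists>Ys. (\<forall>n. Ys n \<in> topspace K // E \<and> \<pi> (Ys n) = E' `` {xs n}) \<and>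
            limitin (quotient_space K E) Ys (E `` {y}) sequentially) \<longleftrightarrow>
        (\<exists>ys. (\<forall>n. (ys n, xs n) \<in> E') \<and> quotient_limit K E ys y)" for y
  proof
    assume "\<exists>Ys. (\<forall>n. Ys n \<in> topspace K // E \<and> \<pi> (Ys n) = E' `` {xs n}) \<and>
            limitin (quotient_space K E) Ys (E `` {y}) sequentially"
    then obtain Ys where Ys: "\<And>n. Ys n \<in> topspace K // E" "\<And>n. \<pi> (Ys n) = E' `` {xs n}"
      "limitin (quotient_space K E) Ys (E `` {y}) sequentially" by blast
    have "\<exists>u. u \<in> topspace K \<and> Ys n = E `` {u}" for n
      using Ys(1)[of n] by (auto simp: quotient_def)
    then obtain ys where ys: "\<And>n. ys n \<in> topspace K" "\<And>n. Ys n = E `` {ys n}" by metis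
    have "(ys n, xs n) \<in> E'" for n
      using p[OF ys(1)[of n] xs'[of n]] Ys(2)[of n] ys(2)[of n] by simp
    moreover have "quotient_limit K E ys y"
    proof -
      have "Ys = (\<lambda>n. E `` {ys n})" using ys(2) by blast
      then show ?thesis using Ys(3) by (simp add: quotient_limit_def)
    qed
    ultimately show "\<exists>ys. (\<forall>n. (ys n, xs n) \<in> E') \<and> quotient_limit K E ys y" by blast
  next
    assume "\<exists>ys. (\<forall>n. (ys n, xs n) \<in> E') \<and> quotient_limit K E ys y"
    then obtain ys where ys: "\<And>n. (ys n, xs n) \<in> E'" "quotient_limit K E ys y" by blast
    then show "\<exists>Ys. (\<forall>n. Ys n \<in> topspace K // E \<and> \<pi> (Ys n) = E' `` {xs n}) \<and>
            limitin (quotient_space K E) Ys (E `` {y}) sequentially"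
      using top[OF ys(1)] p[OF top[OF ys(1)] xs']
      by (intro exI[of _ "\<lambda>n. E `` {ys n}"]) (simp add: quotient_limit_def quotientI)
  qed
  have "map_fiber_convergent (quotient_space K E) (quotient_space K E') \<pi>
      (\<lambda>n. E' `` {xs n}) (E' `` {x}) \<longleftrightarrow>
      (\<forall>Y\<in>topspace K // E. \<pi> Y = E' `` {x} \<longrightarrow>
        (\<exists>Ys. (\<forall>n. Ys n \<in> topspace K // E \<and> \<pi> (Ys n) = E' `` {xs n}) \<and>
            limitin (quotient_space K E) Ys Y sequentially))"
    using \<pi> lim' xs' by (auto simp: map_fiber_convergent_def natural_projection_def intro: quotientI)
  also have "\<dots> \<longleftrightarrow> (\<forall>y\<in>topspace K. \<pi> (E `` {y}) = E' `` {x} \<longrightarrow>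
        (\<exists>ys. (\<forall>n. (ys n, xs n) \<in> E') \<and> quotient_limit K E ys y))"
    by (simp add: lift[symmetric] quotient_def)
  also have "\<dots> \<longleftrightarrow> relation_fiber_convergent K xs x E E'"
    using p x top by (auto simp: relation_fiber_convergent_def)
  finally show ?thesis .
qed

text \<open>Larger quotients have smaller relations, so cofinality becomes containment and the
  supremum of a countable subfamily becomes its intersection.\<close>

definition fiber_convergence_family ::
    "'a topology \<Rightarrow> (nat \<Rightarrow> 'a) \<Rightarrow> 'a \<Rightarrow> ('a \<times> 'a) set set \<Rightarrow> bool" where
  "fiber_convergence_family K xs x \<S> \<longleftrightarrow>
     \<S> \<subseteq> countable_weight_quotients K \<and>
     (\<forall>E\<in>countable_weight_quotients K. \<exists>F\<in>\<S>. F \<subseteq> E) \<and>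
     (\<forall>\<A>\<subseteq>\<S>. countable \<A> \<longrightarrow> topspace K \<times> topspace K \<inter> \<Inter>\<A> \<in> \<S>) \<and>
     (\<forall>E\<in>\<S>. \<forall>E'\<in>\<S>. E \<subseteq> E' \<longrightarrow> relation_fiber_convergent K xs x E E')"

lemma fiber_convergence_familyI:
  assumes "\<S> \<subseteq> countable_weight_quotients K"
    and "\<And>E. E \<in> countable_weight_quotients K \<Longrightarrow> \<exists>F\<in>\<S>. F \<subseteq> E"
    and "\<And>\<A>. \<lbrakk>\<A> \<subseteq> \<S>; countable \<A>\<rbrakk> \<Longrightarrow> topspace K \<times> topspace K \<inter> \<Inter>\<A> \<in> \<S>"
    and "\<And>E E'. \<lbrakk>E \<in> \<S>; E' \<in> \<S>; E \<subseteq> E'\<rbrakk> \<Longrightarrow> relation_fiber_convergent K xs x E E'"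
  shows "fiber_convergence_family K xs x \<S>"
  unfolding fiber_convergence_family_def by (intro conjI ballI allI impI assms)

lemma fiber_convergence_familyD:
  assumes "fiber_convergence_family K xs x \<S>"
  shows "E \<in> \<S> \<Longrightarrow> E \<in> countable_weight_quotients K"
    and "E \<in> countable_weight_quotients K \<Longrightarrow> \<exists>F\<in>\<S>. F \<subseteq> E"
    and "\<lbrakk>\<A> \<subseteq> \<S>; countable \<A>\<rbrakk> \<Longrightarrow> topspace K \<times> topspace K \<inter> \<Inter>\<A> \<in> \<S>"
    and "\<lbrakk>E \<in> \<S>; E' \<in> \<S>; E \<subseteq> E'\<rbrakk> \<Longrightarrow> relation_fiber_convergent K xs x E E'"
  using assms by (auto simp: fiber_convergence_family_def)

text \<open>A natural projection from \<open>K/E\<close> to \<open>K/E'\<close> exists exactly when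
  \<open>E \<subseteq> E'\<close>, and its fiber convergence depends only on the two relations. The
  condition on all natural projections thus collapses to one condition for each such pair.\<close>

lemma fiber_convergent_to_iff:
  "fiber_convergent_to K xs x \<longleftrightarrow>
     compact_space K \<and> Hausdorff_space K \<and> \<not> second_countable K \<and>
     range xs \<subseteq> topspace K \<and> limitin K xs x sequentially \<and>
     (\<exists>\<S>. fiber_convergence_family K xs x \<S>)"
proof -
  have "(cofinal_quotients K \<S> \<and> sigma_semilattice K \<S> \<and>
        (\<forall>E\<in>\<S>. \<forall>E'\<in>\<S>. \<forall>\<pi>. natural_projection K E E' \<pi> \<longrightarrow>
           map_fiber_convergent (quotient_space K E) (quotient_space K E') \<pi>
             (\<lambda>n. E' `` {xs n}) (E' `` {x}))) \<longleftrightarrow> fiber_convergence_family K xs x \<S>"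
    if K: "compact_space K" and xs: "range xs \<subseteq> topspace K" and lim: "limitin K xs x sequentially" for \<S>
  proof (cases "\<S> \<subseteq> countable_weight_quotients K")
    case True
    have eq: "equiv (topspace K) E" if "E \<in> countable_weight_quotients K" for E
      using that by (simp add: countable_weight_quotients_def hausdorff_quotients_def)
    have sub: "\<S> \<subseteq> hausdorff_quotients K"
      using True by (auto simp: countable_weight_quotients_def)
    have le: "quotient_le K E F \<longleftrightarrow> F \<subseteq> E"
      if "E \<in> countable_weight_quotients K" "F \<in> countable_weight_quotients K" for E F
      using quotient_le_iff_supset[OF eq eq] that by blast
    have "cofinal_quotients K \<S> \<longleftrightarrow> (\<forall>E\<in>countable_weight_quotients K. \<exists>F\<in>\<S>. F \<subseteq> E)"
    proof -
      have "(\<exists>F\<in>\<S>. quotient_le K E F) \<longleftrightarrow> (\<exists>F\<in>\<S>. F \<subseteq> E)" if "E \<in> countable_weight_quotients K" for E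
        by (rule bex_cong[OF refl]) (use le[OF that] True in blast)
      then show ?thesis using True by (simp add: cofinal_quotients_def)
    qed
    moreover have "sigma_semilattice K \<S> \<longleftrightarrow>
        (\<forall>\<A>\<subseteq>\<S>. countable \<A> \<longrightarrow> topspace K \<times> topspace K \<inter> \<Inter>\<A> \<in> \<S>)"
    proof -
      have "(\<exists>E\<in>\<S>. is_quotient_sup K \<A> E) \<longleftrightarrow> topspace K \<times> topspace K \<inter> \<Inter>\<A> \<in> \<S>"
        if "\<A> \<subseteq> \<S>" for \<A>
        using is_quotient_sup_iff[OF K subset_trans[OF that sub]] by simp
      then show ?thesis using True by (auto simp: sigma_semilattice_def)
    qed
    moreover have "(\<forall>\<pi>. natural_projection K E E' \<pi> \<longrightarrow>
           map_fiber_convergent (quotient_space K E) (quotient_space K E') \<pi>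
             (\<lambda>n. E' `` {xs n}) (E' `` {x})) \<longleftrightarrow>
          (E \<subseteq> E' \<longrightarrow> relation_fiber_convergent K xs x E E')"
      if "E \<in> \<S>" "E' \<in> \<S>" for E E'
      using map_fiber_convergent_natural_projection[OF _ eq eq xs lim] le[of E' E] True that
      unfolding quotient_le_def by blast
    ultimately show ?thesis
      using True by (simp add: fiber_convergence_family_def)
  next
    case False
    then show ?thesis by (simp add: fiber_convergence_family_def cofinal_quotients_def)
  qed
  then show ?thesis unfolding fiber_convergent_to_def by blast
qed

section \<open>Weight of products and of quotients by countably many functions\<close>

lemma second_countable_prod_topology:
  assumes "second_countable X" "second_countable Y"
  shows "second_countable (prod_topology X Y)"
proof -
  obtain \<A> where A: "countable \<A>" "\<And>U. U \<in> \<A> \<Longrightarrow> openin X U"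
    "\<And>U x. openin X U \<Longrightarrow> x \<in> U \<Longrightarrow> \<exists>V\<in>\<A>. x \<in> V \<and> V \<subseteq> U"
    using assms(1) unfolding second_countable_def by meson
  obtain \<B> where B: "countable \<B>" "\<And>U. U \<in> \<B> \<Longrightarrow> openin Y U"
    "\<And>U x. openin Y U \<Longrightarrow> x \<in> U \<Longrightarrow> \<exists>V\<in>\<B>. x \<in> V \<and> V \<subseteq> U"
    using assms(2) unfolding second_countable_def by meson
  let ?C = "(\<lambda>(U, V). U \<times> V) ` (\<A> \<times> \<B>)"
  have "\<exists>W\<in>?C. x \<in> W \<and> W \<subseteq> S" if S: "openin (prod_topology X Y) S" and xS: "x \<in> S" for S x
  proof -
    obtain a b where x: "x = (a, b)" by (cases x)
    then obtain U V where "openin X U" "openin Y V" "a \<in> U" "b \<in> V" "U \<times> V \<subseteq> S"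
      using S[unfolded openin_prod_topology_alt] xS by meson
    moreover obtain U' where "U' \<in> \<A>" "a \<in> U'" "U' \<subseteq> U"
      using A(3) \<open>openin X U\<close> \<open>a \<in> U\<close> by blast
    moreover obtain V' where "V' \<in> \<B>" "b \<in> V'" "V' \<subseteq> V"
      using B(3) \<open>openin Y V\<close> \<open>b \<in> V\<close> by blast
    ultimately have "U' \<times> V' \<in> ?C \<and> x \<in> U' \<times> V' \<and> U' \<times> V' \<subseteq> S" using x by auto
    then show ?thesis by blast
  qed
  moreover have "countable ?C" using A(1) B(1) by simp
  moreover have "\<forall>W\<in>?C. openin (prod_topology X Y) W"
    using A(2) B(2) by (auto simp: openin_prod_Times_iff)
  ultimately show ?thesis
    unfolding second_countable_def by (intro exI[of _ ?C] conjI allI impI) simp_all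
qed

text \<open>The relation is the kernel of a map into the second countable space
  \<open>nat \<Rightarrow> real\<close> whose coordinates enumerate \<open>\<Phi>\<close>.\<close>

lemma countable_functions_kernel_in_countable_weight_quotients:
  fixes \<Phi> :: "('a \<Rightarrow> real) set"
  assumes X: "compact_space X" and \<Phi>: "countable \<Phi>" "\<And>f. f \<in> \<Phi> \<Longrightarrow> continuous_map X euclideanreal f"
  shows "{(x, y). x \<in> topspace X \<and> y \<in> topspace X \<and> (\<forall>f\<in>\<Phi>. f x = f y)} \<in> countable_weight_quotients X"
proof -
  \<comment> \<open>The zero function makes the set nonempty, so that \<open>nat\<close> can
    enumerate it; being constant, it leaves the relation unchanged.\<close>
  let ?\<Phi> = "insert (\<lambda>_. 0) \<Phi>"
  define e where "e = from_nat_into ?\<Phi>"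
  have range: "range e = ?\<Phi>" unfolding e_def using \<Phi>(1) by (intro range_from_nat_into) auto
  have "continuous_map X euclideanreal (e n)" for n
  proof -
    have "e n \<in> ?\<Phi>" using range by blast
    then show ?thesis using \<Phi>(2) by auto
  qed
  then have "continuous_map X (product_topology (\<lambda>_::nat. euclideanreal) UNIV) (\<lambda>x n. e n x)"
    by (simp add: continuous_map_componentwise_UNIV)
  then have cont: "continuous_map X (euclidean :: (nat \<Rightarrow> real) topology) (\<lambda>x n. e n x)"
    by (simp add: euclidean_product_topology)
  obtain \<B> :: "(nat \<Rightarrow> real) set set" where "countable \<B>" "topological_basis \<B>"
    using ex_countable_basis by blast
  then have "second_countable (euclidean :: (nat \<Rightarrow> real) topology)"
    unfolding second_countable_def topological_basis_iff
    by (metis open_openin topological_basisE topological_basis_open \<open>topological_basis \<B>\<close>)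
  then have "map_kernel X (\<lambda>x n. e n x) \<in> countable_weight_quotients X"
    using map_kernel_in_countable_weight_quotients[OF X _ cont] by simp
  moreover have "(\<lambda>n. e n x) = (\<lambda>n. e n y) \<longleftrightarrow> (\<forall>f\<in>\<Phi>. f x = f y)" for x y
  proof -
    have "(\<lambda>n. e n x) = (\<lambda>n. e n y) \<longleftrightarrow> (\<forall>f\<in>range e. f x = f y)" by (auto simp: fun_eq_iff)
    then show ?thesis unfolding range by simp
  qed
  ultimately show ?thesis by (simp add: map_kernel_def)
qed

section \<open>Products of two compact spaces\<close>

text \<open>The product is presented through coordinate maps \<open>p\<close> and \<open>q\<close>,
  because the dual ball of the sum is only homeomorphic to the product of the two dual balls.
  Nonempty factors make the coordinate maps surjective and provide slices.\<close>

locale product_presentation =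
  fixes M :: "'m topology" and K :: "'k topology" and L :: "'l topology"
    and p :: "'m \<Rightarrow> 'k" and q :: "'m \<Rightarrow> 'l"
  assumes homeo: "homeomorphic_map M (prod_topology K L) (\<lambda>z. (p z, q z))"
    and compact_fst: "compact_space K" and compact_snd: "compact_space L"
    and Hausdorff_fst: "Hausdorff_space K" and Hausdorff_snd: "Hausdorff_space L"
    and nonempty_fst: "topspace K \<noteq> {}" and nonempty_snd: "topspace L \<noteq> {}"
begin

text \<open>The quotient of \<open>M\<close> by this relation is the product of \<open>K/E\<close>
  and \<open>L/F\<close>.\<close>

definition prod_rel :: "('k \<times> 'k) set \<Rightarrow> ('l \<times> 'l) set \<Rightarrow> ('m \<times> 'm) set" where
  "prod_rel E F = {(z, w). z \<in> topspace M \<and> w \<in> topspace M \<and> (p z, p w) \<in> E \<and> (q z, q w) \<in> F}"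

lemma continuous_pair: "continuous_map M (prod_topology K L) (\<lambda>z. (p z, q z))"
  using homeo homeomorphic_imp_continuous_map by blast

lemma continuous_fst: "continuous_map M K p" and continuous_snd: "continuous_map M L q"
  using continuous_pair by (simp_all add: continuous_map_pairwise o_def)

lemma fst_in: "z \<in> topspace M \<Longrightarrow> p z \<in> topspace K" and snd_in: "z \<in> topspace M \<Longrightarrow> q z \<in> topspace L"
  using continuous_fst continuous_snd by (auto simp: continuous_map_def)

lemma pair_surj:
  assumes "a \<in> topspace K" "b \<in> topspace L"
  obtains z where "z \<in> topspace M" "p z = a" "q z = b"
proof -
  have "(a, b) \<in> (\<lambda>z. (p z, q z)) ` topspace M"
    using homeomorphic_imp_surjective_map[OF homeo] assms by simp
  then show thesis using that by auto
qed

lemma compact_product: "compact_space M"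
  using homeo compact_fst compact_snd homeomorphic_compact_space
    homeomorphic_map_imp_homeomorphic_space compact_space_prod_topology by metis

lemma Hausdorff_product: "Hausdorff_space M"
  using homeo Hausdorff_fst Hausdorff_snd homeomorphic_Hausdorff_space
    homeomorphic_map_imp_homeomorphic_space Hausdorff_space_prod_topology by metis

text \<open>The coordinate map \<open>p\<close> is a continuous open surjection, and such maps
  preserve second countability.\<close>

lemma not_second_countable_product:
  assumes "\<not> second_countable K"
  shows "\<not> second_countable M"
proof
  assume "second_countable M"
  moreover have "open_map M K (fst \<circ> (\<lambda>z. (p z, q z)))"
    using homeomorphic_imp_open_map[OF homeo] open_map_fst by (rule open_map_compose)
  then have "open_map M K p" by (simp add: o_def)
  moreover have "p ` topspace M = topspace K"
  proof -
    obtain b where "b \<in> topspace L" using nonempty_snd by blast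
    then have "a \<in> p ` topspace M" if "a \<in> topspace K" for a
      using pair_surj[OF that] by blast
    then show ?thesis using fst_in by blast
  qed
  ultimately have "second_countable K" using second_countable_open_map_image continuous_fst by metis
  with assms show False by blast
qed

lemma equiv_subset: "E \<in> hausdorff_quotients K \<Longrightarrow> E \<subseteq> topspace K \<times> topspace K"
  by (auto simp: hausdorff_quotients_def equiv_def refl_on_def)

lemma prod_rel_eq_map_kernel:
  assumes E: "equiv (topspace K) E" and F: "equiv (topspace L) F"
  shows "prod_rel E F = map_kernel M (\<lambda>z. (E `` {p z}, F `` {q z}))"
proof -
  have "(p z, p w) \<in> E \<and> (q z, q w) \<in> F \<longleftrightarrow> E `` {p z} = E `` {p w} \<and> F `` {q z} = F `` {q w}"
    if "z \<in> topspace M" "w \<in> topspace M" for z w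
    using eq_equiv_class_iff[OF E] eq_equiv_class_iff[OF F] fst_in snd_in that by simp
  then show ?thesis by (auto simp only: prod_rel_def map_kernel_def prod.inject)
qed

text \<open>All three facts come from viewing \<open>prod_rel E F\<close> as the kernel of a map
  into the Hausdorff product of \<open>K/E\<close> and \<open>L/F\<close>, where limits are
  coordinatewise and countable bases multiply.\<close>

lemma prod_rel_hausdorff_quotient:
  assumes E: "E \<in> hausdorff_quotients K" and F: "F \<in> hausdorff_quotients L"
  shows "prod_rel E F \<in> hausdorff_quotients M"
    and "\<lbrakk>range zs \<subseteq> topspace M; z \<in> topspace M\<rbrakk> \<Longrightarrow> quotient_limit M (prod_rel E F) zs z \<longleftrightarrow>
      quotient_limit K E (p \<circ> zs) (p z) \<and> quotient_limit L F (q \<circ> zs) (q z)"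
    and "\<lbrakk>second_countable (quotient_space K E); second_countable (quotient_space L F)\<rbrakk>
      \<Longrightarrow> prod_rel E F \<in> countable_weight_quotients M"
proof -
  let ?f = "\<lambda>z. (E `` {p z}, F `` {q z})" and ?Y = "prod_topology (quotient_space K E) (quotient_space L F)"
  have eq: "prod_rel E F = map_kernel M ?f"
    using E F by (intro prod_rel_eq_map_kernel) (auto simp: hausdorff_quotients_def)
  have Y: "Hausdorff_space ?Y"
    using E F by (simp add: Hausdorff_space_prod_topology hausdorff_quotients_def)
  have "continuous_map M (quotient_space K E) ((\<lambda>x. E `` {x}) \<circ> p)"
    "continuous_map M (quotient_space L F) ((\<lambda>x. F `` {x}) \<circ> q)"
    by (rule continuous_map_compose[OF continuous_fst] continuous_map_compose[OF continuous_snd]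
        quotient_imp_continuous_map quotient_map_quotient_space)+
  then have f: "continuous_map M ?Y ?f"
    by (simp add: continuous_map_pairwise o_def)
  show "prod_rel E F \<in> hausdorff_quotients M"
    unfolding eq by (rule map_kernel_in_hausdorff_quotients[OF compact_product Y f])
  show "prod_rel E F \<in> countable_weight_quotients M"
    if "second_countable (quotient_space K E)" "second_countable (quotient_space L F)"
    unfolding eq using that
    by (intro map_kernel_in_countable_weight_quotients[OF compact_product Y f] second_countable_prod_topology)
  show "quotient_limit M (prod_rel E F) zs z \<longleftrightarrow>
      quotient_limit K E (p \<circ> zs) (p z) \<and> quotient_limit L F (q \<circ> zs) (q z)"
    if "range zs \<subseteq> topspace M" "z \<in> topspace M"
    unfolding eq quotient_limit_map_kernel[OF compact_product Y f that]
    by (simp add: limitin_pairwise quotient_limit_def o_def)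
qed

lemma prod_rel_countable_weight_quotient:
  assumes "E \<in> countable_weight_quotients K" "F \<in> countable_weight_quotients L"
  shows "prod_rel E F \<in> countable_weight_quotients M"
  using assms prod_rel_hausdorff_quotient(3) by (simp add: countable_weight_quotients_def)

text \<open>A pair in \<open>E\<close> and a pair in \<open>F\<close> combine to a pair in
  \<open>prod_rel E F\<close> by \<open>pair_surj\<close>. Diagonal pairs, available because both
  spaces are nonempty, let one factor vary alone.\<close>

lemma prod_rel_subset_iff:
  assumes E: "E \<in> hausdorff_quotients K" and F: "F \<in> hausdorff_quotients L"
  shows "prod_rel E F \<subseteq> prod_rel E' F' \<longleftrightarrow> E \<subseteq> E' \<and> F \<subseteq> F'"
proof
  assume sub: "prod_rel E F \<subseteq> prod_rel E' F'"
  have E: "equiv (topspace K) E" and F: "equiv (topspace L) F"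
    using assms by (auto simp: hausdorff_quotients_def)
  have *: "(a, a') \<in> E' \<and> (b, b') \<in> F'" if "(a, a') \<in> E" "(b, b') \<in> F" for a a' b b'
  proof -
    have "a \<in> topspace K" "a' \<in> topspace K" "b \<in> topspace L" "b' \<in> topspace L"
      using that E F by (auto simp: equiv_def refl_on_def)
    then obtain z w where "z \<in> topspace M" "p z = a" "q z = b" "w \<in> topspace M" "p w = a'" "q w = b'"
      using pair_surj by metis
    then have "(z, w) \<in> prod_rel E F" using that by (simp add: prod_rel_def)
    then have "(z, w) \<in> prod_rel E' F'" using sub by blast
    then show ?thesis using \<open>p z = a\<close> \<open>q z = b\<close> \<open>p w = a'\<close> \<open>q w = b'\<close> by (auto simp: prod_rel_def)
  qed
  obtain a b where "a \<in> topspace K" "b \<in> topspace L" using nonempty_fst nonempty_snd by blast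
  then have "(a, a) \<in> E" "(b, b) \<in> F" using E F by (auto simp: equiv_def refl_on_def)
  then show "E \<subseteq> E' \<and> F \<subseteq> F'" using * by auto
qed (auto simp: prod_rel_def)

text \<open>Membership is tested coordinatewise; the squares take care of an empty
  \<open>I\<close>.\<close>

lemma Inter_prod_rel:
  "topspace M \<times> topspace M \<inter> (\<Inter>i\<in>I. prod_rel (e i) (f i)) =
     prod_rel (topspace K \<times> topspace K \<inter> (\<Inter>i\<in>I. e i)) (topspace L \<times> topspace L \<inter> (\<Inter>i\<in>I. f i))"
  using fst_in snd_in by (auto simp: prod_rel_def)

text \<open>\<open>K/E\<close> embeds into \<open>M/(E \<times> F)\<close> along a slice \<open>K \<times> {b}\<close>.\<close>

lemma countable_weight_quotient_fst:
  assumes E: "E \<in> hausdorff_quotients K" and F: "F \<in> hausdorff_quotients L"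
    and prod_rel: "prod_rel E F \<in> countable_weight_quotients M"
  shows "E \<in> countable_weight_quotients K"
proof -
  obtain h where h: "homeomorphic_maps M (prod_topology K L) (\<lambda>z. (p z, q z)) h"
    using homeo homeomorphic_map_maps by blast
  obtain b where b: "b \<in> topspace L" using nonempty_snd by blast
  define s where "s x = h (x, b)" for x
  have "continuous_map K M (h \<circ> (\<lambda>x. (x, b)))"
    using h b by (intro continuous_map_compose[of _ "prod_topology K L"])
      (auto simp: homeomorphic_maps_def continuous_map_pairwise o_def)
  then have s: "continuous_map K M s" by (simp add: s_def[abs_def] o_def)
  have s': "s x \<in> topspace M" "p (s x) = x" "q (s x) = b" if "x \<in> topspace K" for x
    using s that h b by (auto simp: continuous_map_def homeomorphic_maps_def s_def)
  let ?f = "(\<lambda>z. prod_rel E F `` {z}) \<circ> s"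
  have f: "continuous_map K (quotient_space M (prod_rel E F)) ?f"
    by (rule continuous_map_compose[OF s quotient_imp_continuous_map[OF quotient_map_quotient_space]])
  have Z: "Hausdorff_space (quotient_space M (prod_rel E F))" "second_countable (quotient_space M (prod_rel E F))"
      "equiv (topspace M) (prod_rel E F)"
    using prod_rel by (auto simp: countable_weight_quotients_def hausdorff_quotients_def)
  \<comment> \<open>Points of the slice share the second coordinate \<open>b\<close>, so reflexivity
    of \<open>F\<close> at \<open>b\<close> leaves only the condition from \<open>E\<close>.\<close>
  have "(b, b) \<in> F" using F b by (auto simp: hausdorff_quotients_def equiv_def refl_on_def)
  then have "?f x = ?f y \<longleftrightarrow> (x, y) \<in> E" if "x \<in> topspace K" "y \<in> topspace K" for x y
    using eq_equiv_class_iff[OF Z(3) s'(1)[OF that(1)] s'(1)[OF that(2)]] s' that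
    by (simp add: prod_rel_def)
  then have "map_kernel K ?f = E"
    using equiv_subset[OF E] by (auto simp: map_kernel_def)
  then show ?thesis
    using map_kernel_in_countable_weight_quotients[OF compact_fst Z(1) f Z(2)] by simp
qed

section \<open>Product quotients are cofinal\<close>

text \<open>Complete regularity surrounds each point of \<open>C\<close> with a neighborhood inside
  \<open>W\<close> given by \<open>f < 1\<close> and \<open>g < 1\<close>, and compactness leaves
  finitely many of them. If all chosen functions agree at \<open>z\<close> and \<open>w\<close>,
  then \<open>w\<close> lies in every chosen neighborhood that contains \<open>z\<close>, hence in
  \<open>W\<close>.\<close>

lemma finite_separating_functions:
  assumes C: "closedin M C" and W: "openin M W" and "C \<subseteq> W"
  obtains P :: "(('k \<Rightarrow> real) \<times> ('l \<Rightarrow> real)) set" where "finite P"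
    "\<And>f g. (f, g) \<in> P \<Longrightarrow> continuous_map K euclideanreal f \<and> continuous_map L euclideanreal g"
    "\<And>z w. \<lbrakk>z \<in> C; w \<in> topspace M; \<And>f g. (f, g) \<in> P \<Longrightarrow> f (p z) = f (p w) \<and> g (q z) = g (q w)\<rbrakk>
       \<Longrightarrow> w \<in> W"
proof -
  \<comment> \<open>The functions chosen below vanish at a given point and equal 1 off a
    neighborhood, so values below 1 force a point into that neighborhood.\<close>
  define N where "N = (\<lambda>(f::'k \<Rightarrow> real, g::'l \<Rightarrow> real). {w \<in> topspace M. f (p w) < 1 \<and> g (q w) < 1})"
  define A where "A = {(f, g). continuous_map K euclideanreal f \<and> continuous_map L euclideanreal g \<and> N (f, g) \<subseteq> W}"
  have regular: "completely_regular_space K" "completely_regular_space L"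
    using compact_fst compact_snd Hausdorff_fst Hausdorff_snd
    by (auto intro: normal_imp_completely_regular_space compact_Hausdorff_or_regular_imp_normal_space)
  have open_N: "openin M (N (f, g))" if "(f, g) \<in> A" for f g
  proof -
    have "continuous_map M euclideanreal (f \<circ> p)" "continuous_map M euclideanreal (g \<circ> q)"
      using that continuous_map_compose continuous_fst continuous_snd unfolding A_def by blast+
    then have "openin M ({w \<in> topspace M. (f \<circ> p) w \<in> {..<1}} \<inter> {w \<in> topspace M. (g \<circ> q) w \<in> {..<1}})"
      by (intro openin_Int openin_continuous_map_preimage[where Y = euclideanreal])
        (simp_all del: o_apply)
    moreover have "N (f, g) = {w \<in> topspace M. (f \<circ> p) w \<in> {..<1}} \<inter> {w \<in> topspace M. (g \<circ> q) w \<in> {..<1}}"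
      by (auto simp: N_def)
    ultimately show ?thesis by simp
  qed
  have cover: "\<exists>fg\<in>A. z \<in> N fg" if "z \<in> C" for z
  proof -
    have z: "z \<in> topspace M" "z \<in> W" using that C closedin_subset \<open>C \<subseteq> W\<close> by auto
    have "openin (prod_topology K L) ((\<lambda>z. (p z, q z)) ` W)"
      using homeomorphic_imp_open_map[OF homeo] W by (simp add: open_map_def)
    moreover have "(p z, q z) \<in> (\<lambda>z. (p z, q z)) ` W" using z by blast
    ultimately have "\<exists>U V. openin K U \<and> openin L V \<and> p z \<in> U \<and> q z \<in> V \<and> U \<times> V \<subseteq> (\<lambda>z. (p z, q z)) ` W"
      by (simp add: openin_prod_topology_alt)
    then obtain U V where U: "openin K U" "p z \<in> U" and V: "openin L V" "q z \<in> V"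
      and UV: "U \<times> V \<subseteq> (\<lambda>z. (p z, q z)) ` W"
      by blast
    obtain f where f: "continuous_map K euclideanreal f" "f (p z) = 0" "f ` (topspace K - U) \<subseteq> {1}"
      using regular(1) U unfolding completely_regular_space_alt' by blast
    obtain g where g: "continuous_map L euclideanreal g" "g (q z) = 0" "g ` (topspace L - V) \<subseteq> {1}"
      using regular(2) V unfolding completely_regular_space_alt' by blast
    have "N (f, g) \<subseteq> W"
    proof
      fix w assume "w \<in> N (f, g)"
      then have w: "w \<in> topspace M" "f (p w) < 1" "g (q w) < 1" by (auto simp: N_def)
      then have "p w \<in> U" "q w \<in> V" using f(3) g(3) fst_in[OF w(1)] snd_in[OF w(1)] by force+
      then have "(p w, q w) \<in> (\<lambda>z. (p z, q z)) ` W" using UV by blast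
      then obtain v where v: "v \<in> W" "p v = p w" "q v = q w" by auto
      \<comment> \<open>\<open>U \<times> V\<close> lies in the image of \<open>W\<close> only;
        injectivity of the pair map leads back to \<open>W\<close> itself.\<close>
      then have "v = w"
        using homeo w(1) openin_subset[OF W] unfolding homeomorphic_map_def inj_on_def by blast
      then show "w \<in> W" using v by simp
    qed
    then have "(f, g) \<in> A \<and> z \<in> N (f, g)" using f g z by (simp add: A_def N_def)
    then show ?thesis by blast
  qed
  have "compactin M C" by (rule closedin_compact_space[OF compact_product C])
  then obtain \<F> where "finite \<F>" "\<F> \<subseteq> N ` A" "C \<subseteq> \<Union>\<F>"
    using compactinD[of M C "N ` A"] open_N cover by fastforce
  then obtain P where P: "finite P" "P \<subseteq> A" "C \<subseteq> \<Union>(N ` P)"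
    using finite_subset_image by metis
  show thesis
  proof (rule that[OF P(1)])
    show "continuous_map K euclideanreal f \<and> continuous_map L euclideanreal g" if "(f, g) \<in> P" for f g
      using that P(2) by (auto simp: A_def)
    show "w \<in> W" if z: "z \<in> C" "w \<in> topspace M"
      "\<And>f g. (f, g) \<in> P \<Longrightarrow> f (p z) = f (p w) \<and> g (q z) = g (q w)" for z w
    proof -
      obtain f g where fg: "(f, g) \<in> P" "z \<in> N (f, g)" using P(3) z(1) by auto
      then have "w \<in> N (f, g)" using z(2) z(3)[OF fg(1)] by (simp add: N_def)
      then show ?thesis using P(2) fg(1) by (auto simp: A_def)
    qed
  qed
qed

text \<open>For basic open sets \<open>U, V\<close> of \<open>M/G\<close> with the closure of \<open>U\<close> inside \<open>V\<close>, finitely many functions of one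
  variable decide whether a point over that closure stays over \<open>V\<close>. The countably many functions arising
  in this way define \<open>E\<close> and \<open>F\<close>.\<close>

lemma prod_rel_refinement:
  assumes G: "G \<in> countable_weight_quotients M"
  obtains E F where "E \<in> countable_weight_quotients K" "F \<in> countable_weight_quotients L" "prod_rel E F \<subseteq> G"
proof -
  let ?Z = "quotient_space M G"
  have eqG: "equiv (topspace M) G" and Z: "Hausdorff_space ?Z" "second_countable ?Z"
    using G by (auto simp: countable_weight_quotients_def hausdorff_quotients_def)
  have pr: "continuous_map M ?Z (\<lambda>z. G `` {z})"
    by (rule quotient_imp_continuous_map[OF quotient_map_quotient_space])
  have "compact_space ?Z"
    by (rule compact_space_quotient_space[OF compact_product])
  then have reg: "neighbourhood_base_of (closedin ?Z) ?Z"
    using Z(1) compact_Hausdorff_imp_regular_space neighbourhood_base_of_closedin by blast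
  obtain \<B> where B: "countable \<B>" "\<And>U. U \<in> \<B> \<Longrightarrow> openin ?Z U"
    "\<And>U x. openin ?Z U \<Longrightarrow> x \<in> U \<Longrightarrow> \<exists>V\<in>\<B>. x \<in> V \<and> V \<subseteq> U"
    using Z(2) unfolding second_countable_def by meson
  define I where "I = {(U, V). U \<in> \<B> \<and> V \<in> \<B> \<and> ?Z closure_of U \<subseteq> V}"
  have "I \<subseteq> \<B> \<times> \<B>" by (auto simp: I_def)
  then have countI: "countable I" using B(1) by (meson countable_SIGMA countable_subset)
  \<comment> \<open>Bundled into one predicate, so that a family \<open>P U V\<close> can be chosen
    simultaneously for all pairs in \<open>I\<close>.\<close>
  define separates :: "_ \<Rightarrow> _ \<Rightarrow> (('k \<Rightarrow> real) \<times> ('l \<Rightarrow> real)) set \<Rightarrow> bool" where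
    "separates U V P \<longleftrightarrow> finite P \<and>
      (\<forall>(f, g)\<in>P. continuous_map K euclideanreal f \<and> continuous_map L euclideanreal g) \<and>
      (\<forall>z w. G `` {z} \<in> ?Z closure_of U \<longrightarrow> z \<in> topspace M \<longrightarrow> w \<in> topspace M \<longrightarrow>
        (\<forall>(f, g)\<in>P. f (p z) = f (p w) \<and> g (q z) = g (q w)) \<longrightarrow> G `` {w} \<in> V)" for U V P
  have "\<exists>P. separates U V P"
    if UV: "(U, V) \<in> I" for U V
  proof -
    let ?C = "{z \<in> topspace M. G `` {z} \<in> ?Z closure_of U}" and ?W = "{z \<in> topspace M. G `` {z} \<in> V}"
    have "closedin M ?C" by (rule closedin_continuous_map_preimage[OF pr closedin_closure_of])
    moreover have "openin M ?W"
      using UV B(2) by (intro openin_continuous_map_preimage[OF pr]) (auto simp: I_def)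
    moreover have "?C \<subseteq> ?W" using UV by (auto simp: I_def)
    ultimately obtain P :: "(('k \<Rightarrow> real) \<times> ('l \<Rightarrow> real)) set" where P: "finite P"
      "\<And>f g. (f, g) \<in> P \<Longrightarrow> continuous_map K euclideanreal f \<and> continuous_map L euclideanreal g"
      "\<And>z w. \<lbrakk>z \<in> ?C; w \<in> topspace M; \<And>f g. (f, g) \<in> P \<Longrightarrow> f (p z) = f (p w) \<and> g (q z) = g (q w)\<rbrakk>
         \<Longrightarrow> w \<in> ?W"
      by (rule finite_separating_functions) blast
    show ?thesis unfolding separates_def
    proof (intro exI[of _ P] conjI allI impI)
      fix z w assume "G `` {z} \<in> ?Z closure_of U" "z \<in> topspace M" "w \<in> topspace M"
        "\<forall>(f, g)\<in>P. f (p z) = f (p w) \<and> g (q z) = g (q w)"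
      then have "w \<in> ?W" using P(3)[of z w] by auto
      then show "G `` {w} \<in> V" by simp
    qed (use P(1,2) in auto)
  qed
  then obtain P where sep: "\<And>U V. (U, V) \<in> I \<Longrightarrow> separates U V (P U V)" by metis
  have P: "finite (P U V)"
    "\<And>f g. (f, g) \<in> P U V \<Longrightarrow> continuous_map K euclideanreal f \<and> continuous_map L euclideanreal g"
    "\<And>z w. \<lbrakk>G `` {z} \<in> ?Z closure_of U; z \<in> topspace M; w \<in> topspace M;
        \<And>f g. (f, g) \<in> P U V \<Longrightarrow> f (p z) = f (p w) \<and> g (q z) = g (q w)\<rbrakk> \<Longrightarrow> G `` {w} \<in> V"
    if "(U, V) \<in> I" for U V
    using sep[OF that] unfolding separates_def by blast+
  define Q where "Q = (\<Union>(U, V)\<in>I. P U V)"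
  have countQ: "countable Q"
    unfolding Q_def using countI P(1) by (intro countable_UN) (auto intro: countable_finite)
  have contQ: "continuous_map K euclideanreal f \<and> continuous_map L euclideanreal g" if "(f, g) \<in> Q" for f g
    using that P(2) unfolding Q_def by blast
  define E where "E = {(x, y). x \<in> topspace K \<and> y \<in> topspace K \<and> (\<forall>f\<in>fst ` Q. f x = f y)}"
  define F where "F = {(x, y). x \<in> topspace L \<and> y \<in> topspace L \<and> (\<forall>g\<in>snd ` Q. g x = g y)}"
  have "E \<in> countable_weight_quotients K" unfolding E_def
    by (rule countable_functions_kernel_in_countable_weight_quotients[OF compact_fst]) (use countQ contQ in auto)
  moreover have "F \<in> countable_weight_quotients L" unfolding F_def
    by (rule countable_functions_kernel_in_countable_weight_quotients[OF compact_snd]) (use countQ contQ in auto)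
  moreover have "prod_rel E F \<subseteq> G"
  proof (rule subrelI, rule ccontr)
    fix z w assume zw: "(z, w) \<in> prod_rel E F" "(z, w) \<notin> G"
    then have z: "z \<in> topspace M" and w: "w \<in> topspace M" by (auto simp: prod_rel_def)
    have ne: "G `` {z} \<noteq> G `` {w}" using zw(2) eq_equiv_class_iff[OF eqG z w] by simp
    have "openin ?Z (topspace ?Z - {G `` {w}})"
      using Z(1) w by (intro openin_diff openin_topspace closedin_Hausdorff_singleton) (auto intro: quotientI)
    \<comment> \<open>\<open>V\<close> avoids the class of \<open>w\<close>, and regularity gives a
      basic \<open>U\<close> around the class of \<open>z\<close> with closure inside
      \<open>V\<close>. The functions in \<open>P U V\<close> agree at \<open>z\<close> and
      \<open>w\<close>, which would put \<open>w\<close> over \<open>V\<close>.\<close>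
    then obtain V where V: "V \<in> \<B>" "G `` {z} \<in> V" "V \<subseteq> topspace ?Z - {G `` {w}}"
      using B(3)[of "topspace ?Z - {G `` {w}}" "G `` {z}"] z ne by (auto intro: quotientI)
    obtain U0 D where D: "openin ?Z U0" "closedin ?Z D" "G `` {z} \<in> U0" "U0 \<subseteq> D" "D \<subseteq> V"
      using reg B(2)[OF V(1)] V(2) unfolding neighbourhood_base_of by metis
    obtain U where U: "U \<in> \<B>" "G `` {z} \<in> U" "U \<subseteq> U0" using B(3)[OF D(1,3)] by blast
    have "?Z closure_of U \<subseteq> D" using U(3) D(2,4) by (intro closure_of_minimal) auto
    then have UV: "(U, V) \<in> I" using U V D(5) by (auto simp: I_def)
    have "G `` {z} \<in> ?Z closure_of U"
      using closure_of_subset[OF openin_subset[OF B(2)[OF U(1)]]] U(2) by blast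
    moreover have "f (p z) = f (p w) \<and> g (q z) = g (q w)" if "(f, g) \<in> P U V" for f g
    proof -
      have "(f, g) \<in> Q" using that UV by (auto simp: Q_def)
      then show ?thesis using zw(1) by (force simp: prod_rel_def E_def F_def)
    qed
    ultimately have "G `` {w} \<in> V" using P(3)[OF UV _ z w] by blast
    then show False using V(3) by blast
  qed
  ultimately show thesis using that by blast
qed

section \<open>Fiber convergence in the product and in its factors\<close>

text \<open>Inclusion of product relations is inclusion in each factor, so lifts are chosen in
  \<open>K\<close> and \<open>L\<close> separately and then paired. Cofinality rests on
  \<open>prod_rel_refinement\<close>, and suprema are formed factorwise.\<close>

lemma fiber_convergence_family_prod_rel:
  assumes zs: "range zs \<subseteq> topspace M" and z: "z \<in> topspace M"
    and SK: "fiber_convergence_family K (p \<circ> zs) (p z) \<S>"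
    and SL: "fiber_convergence_family L (q \<circ> zs) (q z) \<T>"
  shows "fiber_convergence_family M zs z {prod_rel E F |E F. E \<in> \<S> \<and> F \<in> \<T>}"
proof -
  have hS: "E \<in> hausdorff_quotients K" "E \<in> countable_weight_quotients K" if "E \<in> \<S>" for E
    using SK that by (auto simp: fiber_convergence_family_def countable_weight_quotients_def)
  have hT: "F \<in> hausdorff_quotients L" "F \<in> countable_weight_quotients L" if "F \<in> \<T>" for F
    using SL that by (auto simp: fiber_convergence_family_def countable_weight_quotients_def)
  have 1: "{prod_rel E F |E F. E \<in> \<S> \<and> F \<in> \<T>} \<subseteq> countable_weight_quotients M"
    using prod_rel_countable_weight_quotient hS hT by blast
  have 2: "\<exists>H\<in>{prod_rel E F |E F. E \<in> \<S> \<and> F \<in> \<T>}. H \<subseteq> G" if G: "G \<in> countable_weight_quotients M" for G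
  proof -
    obtain E0 F0 where EF: "E0 \<in> countable_weight_quotients K" "F0 \<in> countable_weight_quotients L"
      and sub: "prod_rel E0 F0 \<subseteq> G"
      using prod_rel_refinement[OF G] by blast
    obtain E where E: "E \<in> \<S>" "E \<subseteq> E0" using fiber_convergence_familyD(2)[OF SK EF(1)] by blast
    obtain F where F: "F \<in> \<T>" "F \<subseteq> F0" using fiber_convergence_familyD(2)[OF SL EF(2)] by blast
    have "prod_rel E F \<subseteq> prod_rel E0 F0" using E(2) F(2) by (auto simp: prod_rel_def)
    then show ?thesis using E(1) F(1) sub by blast
  qed
  have 3: "topspace M \<times> topspace M \<inter> \<Inter>\<A> \<in> {prod_rel E F |E F. E \<in> \<S> \<and> F \<in> \<T>}"
    if A: "\<A> \<subseteq> {prod_rel E F |E F. E \<in> \<S> \<and> F \<in> \<T>}" "countable \<A>" for \<A>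
  proof -
    have "\<forall>G\<in>\<A>. \<exists>E F. E \<in> \<S> \<and> F \<in> \<T> \<and> G = prod_rel E F" using A(1) by blast
    then obtain e f where ef: "\<And>G. G \<in> \<A> \<Longrightarrow> e G \<in> \<S>" "\<And>G. G \<in> \<A> \<Longrightarrow> f G \<in> \<T>"
      "\<And>G. G \<in> \<A> \<Longrightarrow> G = prod_rel (e G) (f G)" by metis
    have "topspace M \<times> topspace M \<inter> \<Inter>\<A> = topspace M \<times> topspace M \<inter> (\<Inter>G\<in>\<A>. prod_rel (e G) (f G))"
      using ef(3) by auto
    also have "\<dots> = prod_rel (topspace K \<times> topspace K \<inter> \<Inter>(e ` \<A>)) (topspace L \<times> topspace L \<inter> \<Inter>(f ` \<A>))"
      by (rule Inter_prod_rel)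
    finally have eq: "topspace M \<times> topspace M \<inter> \<Inter>\<A> = \<dots>" .
    have "topspace K \<times> topspace K \<inter> \<Inter>(e ` \<A>) \<in> \<S>"
    proof -
      have "e ` \<A> \<subseteq> \<S>" "countable (e ` \<A>)" using ef(1) A(2) by auto
      then show ?thesis by (rule fiber_convergence_familyD(3)[OF SK])
    qed
    moreover have "topspace L \<times> topspace L \<inter> \<Inter>(f ` \<A>) \<in> \<T>"
    proof -
      have "f ` \<A> \<subseteq> \<T>" "countable (f ` \<A>)" using ef(2) A(2) by auto
      then show ?thesis by (rule fiber_convergence_familyD(3)[OF SL])
    qed
    ultimately show ?thesis unfolding eq by blast
  qed
  have 4: "relation_fiber_convergent M zs z (prod_rel E F) (prod_rel E' F')"
    if mem: "E \<in> \<S>" "F \<in> \<T>" "E' \<in> \<S>" "F' \<in> \<T>" and sub: "prod_rel E F \<subseteq> prod_rel E' F'" for E F E' F'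
    unfolding relation_fiber_convergent_def
  proof (intro allI impI)
    fix w assume w: "(w, z) \<in> prod_rel E' F'"
    have "E \<subseteq> E'" "F \<subseteq> F'" using sub prod_rel_subset_iff hS hT mem by blast+
    then have rE: "relation_fiber_convergent K (p \<circ> zs) (p z) E E'"
      and rF: "relation_fiber_convergent L (q \<circ> zs) (q z) F F'"
      using fiber_convergence_familyD(4)[OF SK] fiber_convergence_familyD(4)[OF SL] mem by blast+
    obtain us where us: "\<And>n. (us n, p (zs n)) \<in> E'" "quotient_limit K E us (p w)"
      using rE w by (auto simp: relation_fiber_convergent_def prod_rel_def)
    obtain vs where vs: "\<And>n. (vs n, q (zs n)) \<in> F'" "quotient_limit L F vs (q w)"
      using rF w by (auto simp: relation_fiber_convergent_def prod_rel_def)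
    have "us n \<in> topspace K" "vs n \<in> topspace L" for n
      using us(1)[of n] vs(1)[of n] hS(1)[OF mem(3)] hT(1)[OF mem(4)]
      by (auto simp: hausdorff_quotients_def equiv_def refl_on_def)
    then have "\<exists>v. v \<in> topspace M \<and> p v = us n \<and> q v = vs n" for n
      using pair_surj by metis
    then obtain ws where ws: "\<And>n. ws n \<in> topspace M" "\<And>n. p (ws n) = us n" "\<And>n. q (ws n) = vs n"
      by metis
    have "(ws n, zs n) \<in> prod_rel E' F'" for n
      using ws us(1) vs(1) zs by (auto simp: prod_rel_def)
    moreover have "quotient_limit M (prod_rel E F) ws w"
    proof (subst prod_rel_hausdorff_quotient(2)[OF hS(1)[OF mem(1)] hT(1)[OF mem(2)]])
      show "range ws \<subseteq> topspace M" "w \<in> topspace M" using ws(1) w by (auto simp: prod_rel_def)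
      show "quotient_limit K E (p \<circ> ws) (p w) \<and> quotient_limit L F (q \<circ> ws) (q w)"
        using us(2) vs(2) ws(2,3) by (simp add: o_def)
    qed
    ultimately show "\<exists>ws. (\<forall>n. (ws n, zs n) \<in> prod_rel E' F') \<and> quotient_limit M (prod_rel E F) ws w"
      by blast
  qed
  show ?thesis
  proof (rule fiber_convergence_familyI[OF 1 2 3])
    fix G G' assume "G \<in> {prod_rel E F |E F. E \<in> \<S> \<and> F \<in> \<T>}" "G' \<in> {prod_rel E F |E F. E \<in> \<S> \<and> F \<in> \<T>}" "G \<subseteq> G'"
    then show "relation_fiber_convergent M zs z G G'" using 4 by auto
  qed
qed

text \<open>The limit in \<open>M\<close> is recovered through the inverse homeomorphism,
  uncountable weight is inherited from \<open>K\<close>, and the products of the two given families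
  are the witness.\<close>

lemma fiber_convergent_to_pair:
  assumes K: "fiber_convergent_to K (p \<circ> zs) (p z)" and L: "fiber_convergent_to L (q \<circ> zs) (q z)"
    and zs: "range zs \<subseteq> topspace M" and z: "z \<in> topspace M"
  shows "fiber_convergent_to M zs z"
proof -
  obtain h where h: "homeomorphic_maps M (prod_topology K L) (\<lambda>z. (p z, q z)) h"
    using homeo homeomorphic_map_maps by blast
  have hz: "h (p w, q w) = w" if "w \<in> topspace M" for w
    using h that by (simp add: homeomorphic_maps_def)
  have "limitin (prod_topology K L) (\<lambda>n. (p (zs n), q (zs n))) (p z, q z) sequentially"
    using K L by (simp add: limitin_pairwise o_def fiber_convergent_to_def)
  then have "limitin M (h \<circ> (\<lambda>n. (p (zs n), q (zs n)))) (h (p z, q z)) sequentially"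
    by (rule continuous_map_limit[rotated]) (use h in \<open>simp add: homeomorphic_maps_def\<close>)
  moreover have "h \<circ> (\<lambda>n. (p (zs n), q (zs n))) = zs"
    using hz zs by (auto simp: fun_eq_iff)
  ultimately have "limitin M zs z sequentially" using hz z by simp
  moreover have "\<exists>\<S>. fiber_convergence_family M zs z \<S>"
    using K L fiber_convergence_family_prod_rel[OF zs z] unfolding fiber_convergent_to_iff by blast
  moreover have "\<not> second_countable M"
    using K not_second_countable_product by (simp add: fiber_convergent_to_def)
  ultimately show ?thesis
    using compact_product Hausdorff_product zs by (simp add: fiber_convergent_to_iff)
qed

text \<open>Members of \<open>\<S>\<close> and product relations are interlaced in one decreasing sequence; its intersection is both.\<close>

lemma fiber_convergence_family_cofinal_prod_rel:
  assumes S: "fiber_convergence_family M zs z \<S>" and G0: "G0 \<in> countable_weight_quotients M"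
  obtains E F where "E \<in> hausdorff_quotients K" "F \<in> hausdorff_quotients L" "prod_rel E F \<in> \<S>" "prod_rel E F \<subseteq> G0"
proof -
  have cof: "\<exists>H\<in>\<S>. H \<subseteq> G" if "G \<in> countable_weight_quotients M" for G
    by (rule fiber_convergence_familyD(2)[OF S that])
  have CW: "G \<in> countable_weight_quotients M" if "G \<in> \<S>" for G
    by (rule fiber_convergence_familyD(1)[OF S that])
  \<comment> \<open>One round of the descent: a product relation inside \<open>G\<close>, then a
    member \<open>H\<close> of \<open>\<S>\<close> inside that product.\<close>
  define good where "good G E F H \<longleftrightarrow> E \<in> countable_weight_quotients K \<and> F \<in> countable_weight_quotients L \<and>
      prod_rel E F \<subseteq> G \<and> H \<in> \<S> \<and> H \<subseteq> prod_rel E F" for G E F H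
  have "\<exists>E F H. good G E F H" if G: "G \<in> \<S>" for G
  proof -
    obtain E F where "E \<in> countable_weight_quotients K" "F \<in> countable_weight_quotients L" "prod_rel E F \<subseteq> G"
      using prod_rel_refinement[OF CW[OF G]] by blast
    moreover from this obtain H where "H \<in> \<S>" "H \<subseteq> prod_rel E F"
      using cof[OF prod_rel_countable_weight_quotient] by blast
    ultimately show ?thesis unfolding good_def by blast
  qed
  then obtain e f h where step: "\<And>G. G \<in> \<S> \<Longrightarrow> good G (e G) (f G) (h G)" by metis
  obtain G1 where G1: "G1 \<in> \<S>" "G1 \<subseteq> G0" using cof[OF G0] by blast
  define G where "G n = (h ^^ n) G1" for n
  have G0': "G 0 = G1" and GS: "G (Suc n) = h (G n)" for n by (simp_all add: G_def)
  have mem: "G n \<in> \<S>" for n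
    by (induction n) (use G1 step in \<open>auto simp: G0' GS good_def\<close>)
  have good: "good (G n) (e (G n)) (f (G n)) (G (Suc n))" for n
    using step[OF mem] by (simp add: GS)
  let ?E = "topspace K \<times> topspace K \<inter> (\<Inter>n. e (G n))" and ?F = "topspace L \<times> topspace L \<inter> (\<Inter>n. f (G n))"
  \<comment> \<open>Since \<open>G (Suc n) \<subseteq> prod_rel (e (G n)) (f (G n)) \<subseteq> G
    n\<close>, both sequences have the same intersection.\<close>
  have "topspace M \<times> topspace M \<inter> (\<Inter>n. G n) = topspace M \<times> topspace M \<inter> (\<Inter>n. prod_rel (e (G n)) (f (G n)))"
    using good unfolding good_def by blast
  also have "\<dots> = prod_rel ?E ?F" by (rule Inter_prod_rel)
  finally have eq: "topspace M \<times> topspace M \<inter> (\<Inter>n. G n) = prod_rel ?E ?F" .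
  have "range G \<subseteq> \<S>" "countable (range G)" using mem by auto
  then have "topspace M \<times> topspace M \<inter> \<Inter>(range G) \<in> \<S>"
    by (rule fiber_convergence_familyD(3)[OF S])
  then have "prod_rel ?E ?F \<in> \<S>" by (simp only: eq)
  moreover have "?E \<in> hausdorff_quotients K"
    using good by (intro Inter_in_hausdorff_quotients[OF compact_fst]) (auto simp: good_def countable_weight_quotients_def)
  moreover have "?F \<in> hausdorff_quotients L"
    using good by (intro Inter_in_hausdorff_quotients[OF compact_snd]) (auto simp: good_def countable_weight_quotients_def)
  moreover have "prod_rel ?E ?F \<subseteq> G0" using G1(2) G0' eq by blast
  ultimately show thesis using that by blast
qed

text \<open>If \<open>E \<subseteq> E'\<close> come with \<open>F\<close> and \<open>F'\<close>, then \<open>E \<times> F\<close> may be replaced by the supremum \<open>E \<times> (F \<inter> F')\<close>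
  of \<open>E \<times> F\<close> and \<open>E' \<times> F'\<close>, which is comparable with \<open>E' \<times> F'\<close>.\<close>

lemma fiber_convergence_family_fst:
  assumes S: "fiber_convergence_family M zs z \<S>" and zs: "range zs \<subseteq> topspace M" and z: "z \<in> topspace M"
  shows "fiber_convergence_family K (p \<circ> zs) (p z)
    {E \<in> hausdorff_quotients K. \<exists>F\<in>hausdorff_quotients L. prod_rel E F \<in> \<S>}" (is "fiber_convergence_family _ _ _ ?T")
proof -
  have CW: "G \<in> countable_weight_quotients M" if "G \<in> \<S>" for G
    by (rule fiber_convergence_familyD(1)[OF S that])
  have Int: "topspace M \<times> topspace M \<inter> \<Inter>\<A> \<in> \<S>" if "\<A> \<subseteq> \<S>" "countable \<A>" for \<A>
    by (rule fiber_convergence_familyD(3)[OF S that])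
  have 1: "?T \<subseteq> countable_weight_quotients K"
    using countable_weight_quotient_fst CW by blast
  \<comment> \<open>The one-point quotient of \<open>L\<close>, obtained as the kernel of the empty
    family of functions; multiplied by it, \<open>E0\<close> becomes a quotient of
    \<open>M\<close>.\<close>
  have trivial: "topspace L \<times> topspace L \<in> countable_weight_quotients L"
  proof -
    have "{(x, y). x \<in> topspace L \<and> y \<in> topspace L \<and> (\<forall>f\<in>{}. f x = (f y :: real))} \<in> countable_weight_quotients L"
      by (rule countable_functions_kernel_in_countable_weight_quotients[OF compact_snd]) auto
    moreover have "{(x, y). x \<in> topspace L \<and> y \<in> topspace L \<and> (\<forall>f\<in>{}. f x = (f y :: real))} = topspace L \<times> topspace L"
      by auto
    ultimately show ?thesis by simp
  qed
  have 2: "\<exists>E\<in>?T. E \<subseteq> E0" if E0: "E0 \<in> countable_weight_quotients K" for E0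
  proof -
    obtain E F where EF: "E \<in> hausdorff_quotients K" "F \<in> hausdorff_quotients L" "prod_rel E F \<in> \<S>"
      and sub: "prod_rel E F \<subseteq> prod_rel E0 (topspace L \<times> topspace L)"
      using fiber_convergence_family_cofinal_prod_rel[OF S prod_rel_countable_weight_quotient[OF E0 trivial]] by blast
    have "E \<subseteq> E0" using sub prod_rel_subset_iff[OF EF(1,2)] by blast
    then show ?thesis using EF by blast
  qed
  have 3: "topspace K \<times> topspace K \<inter> \<Inter>\<A> \<in> ?T" if A: "\<A> \<subseteq> ?T" "countable \<A>" for \<A>
  proof -
    \<comment> \<open>One partner \<open>f E\<close> is fixed for each \<open>E\<close>, since the
      semilattice property applies to the product relations in \<open>\<S>\<close>.\<close>
    have "\<forall>E\<in>\<A>. \<exists>F. F \<in> hausdorff_quotients L \<and> prod_rel E F \<in> \<S>" using A(1) by blast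
    from bchoice[OF this] obtain f where
      f: "\<And>E. E \<in> \<A> \<Longrightarrow> f E \<in> hausdorff_quotients L" "\<And>E. E \<in> \<A> \<Longrightarrow> prod_rel E (f E) \<in> \<S>"
      by blast
    have "(\<lambda>E. prod_rel E (f E)) ` \<A> \<subseteq> \<S>" "countable ((\<lambda>E. prod_rel E (f E)) ` \<A>)" using f(2) A(2) by auto
    then have "topspace M \<times> topspace M \<inter> (\<Inter>E\<in>\<A>. prod_rel E (f E)) \<in> \<S>" by (rule Int)
    then have "prod_rel (topspace K \<times> topspace K \<inter> \<Inter>\<A>) (topspace L \<times> topspace L \<inter> (\<Inter>E\<in>\<A>. f E)) \<in> \<S>"
      unfolding Inter_prod_rel by simp
    moreover have "topspace K \<times> topspace K \<inter> \<Inter>\<A> \<in> hausdorff_quotients K"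
      using A(1) by (intro Inter_in_hausdorff_quotients[OF compact_fst]) auto
    moreover have "topspace L \<times> topspace L \<inter> (\<Inter>E\<in>\<A>. f E) \<in> hausdorff_quotients L"
      using f(1) by (intro Inter_in_hausdorff_quotients[OF compact_snd]) auto
    ultimately show ?thesis by blast
  qed
  have 4: "relation_fiber_convergent K (p \<circ> zs) (p z) E E'"
    if mem: "E \<in> ?T" "E' \<in> ?T" and sub: "E \<subseteq> E'" for E E'
    unfolding relation_fiber_convergent_def
  proof (intro allI impI)
    fix y assume y: "(y, p z) \<in> E'"
    obtain F where F: "F \<in> hausdorff_quotients L" "prod_rel E F \<in> \<S>" using mem(1) by blast
    obtain F' where F': "F' \<in> hausdorff_quotients L" "prod_rel E' F' \<in> \<S>" using mem(2) by blast
    have EF: "E \<in> hausdorff_quotients K" "E' \<in> hausdorff_quotients K" using mem by blast+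
    let ?F = "topspace L \<times> topspace L \<inter> \<Inter>{F, F'}"
    have hF: "?F \<in> hausdorff_quotients L"
      using F(1) F'(1) by (intro Inter_in_hausdorff_quotients[OF compact_snd]) auto
    have "topspace M \<times> topspace M \<inter> \<Inter>{prod_rel E F, prod_rel E' F'} = prod_rel E ?F"
      using sub snd_in by (auto simp: prod_rel_def)
    moreover have "topspace M \<times> topspace M \<inter> \<Inter>{prod_rel E F, prod_rel E' F'} \<in> \<S>"
      using F(2) F'(2) by (intro Int) auto
    ultimately have "prod_rel E ?F \<in> \<S>" by simp
    moreover have "prod_rel E ?F \<subseteq> prod_rel E' F'" using sub by (auto simp: prod_rel_def)
    ultimately have r: "relation_fiber_convergent M zs z (prod_rel E ?F) (prod_rel E' F')"
      using fiber_convergence_familyD(4)[OF S] F'(2) by blast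
    have "y \<in> topspace K" using y EF(2) equiv_subset by blast
    \<comment> \<open>\<open>y\<close> is lifted with the second coordinate of \<open>z\<close>, so
      that in this coordinate \<open>w\<close> and \<open>z\<close> are related by reflexivity of
      \<open>F'\<close>.\<close>
    then obtain w where w: "w \<in> topspace M" "p w = y" "q w = q z" using pair_surj snd_in[OF z] by metis
    have "(q z, q z) \<in> F'" using F'(1) snd_in[OF z] by (auto simp: hausdorff_quotients_def equiv_def refl_on_def)
    then have "(w, z) \<in> prod_rel E' F'" using w y z by (simp add: prod_rel_def)
    then obtain ws where ws: "\<And>n. (ws n, zs n) \<in> prod_rel E' F'" "quotient_limit M (prod_rel E ?F) ws w"
      using r unfolding relation_fiber_convergent_def by blast
    have "range ws \<subseteq> topspace M" using ws(1) by (auto simp: prod_rel_def)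
    then have "quotient_limit K E (p \<circ> ws) (p w)"
      using ws(2) prod_rel_hausdorff_quotient(2)[OF EF(1) hF _ w(1)] by blast
    moreover have "(p (ws n), p (zs n)) \<in> E'" for n using ws(1)[of n] by (simp add: prod_rel_def)
    ultimately show "\<exists>ys. (\<forall>n. (ys n, (p \<circ> zs) n) \<in> E') \<and> quotient_limit K E ys y"
      using w(2) by (intro exI[of _ "p \<circ> ws"]) simp
  qed
  show ?thesis by (rule fiber_convergence_familyI[OF 1 2 3 4])
qed

lemma fiber_convergent_to_fst:
  assumes M: "fiber_convergent_to M zs z" and K: "\<not> second_countable K"
  shows "fiber_convergent_to K (p \<circ> zs) (p z)"
proof -
  have zs: "range zs \<subseteq> topspace M" and lim: "limitin M zs z sequentially"
    using M by (auto simp: fiber_convergent_to_def)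
  obtain \<S> where "fiber_convergence_family M zs z \<S>"
    using M unfolding fiber_convergent_to_iff by blast
  then have "\<exists>\<S>. fiber_convergence_family K (p \<circ> zs) (p z) \<S>"
    using fiber_convergence_family_fst zs limitin_topspace[OF lim] by blast
  moreover have "limitin K (p \<circ> zs) (p z) sequentially"
    by (rule continuous_map_limit[OF continuous_fst lim])
  ultimately show ?thesis
    using compact_fst Hausdorff_fst K zs fst_in by (auto simp: fiber_convergent_to_iff)
qed

text \<open>The two factors play symmetric roles, so results on the first coordinate transfer to the
  second.\<close>

lemma product_presentation_swap: "product_presentation M L K q p"
proof
  have "homeomorphic_map M (prod_topology L K) ((\<lambda>(x, y). (y, x)) \<circ> (\<lambda>z. (p z, q z)))"
    by (rule homeomorphic_map_compose[OF homeo homeomorphic_map_swap])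
  then show "homeomorphic_map M (prod_topology L K) (\<lambda>z. (q z, p z))" by (simp add: o_def)
qed (rule compact_fst compact_snd Hausdorff_fst Hausdorff_snd nonempty_fst nonempty_snd)+

lemma fiber_convergent_to_snd:
  assumes "fiber_convergent_to M zs z" and "\<not> second_countable L"
  shows "fiber_convergent_to L (q \<circ> zs) (q z)"
  using assms by (rule product_presentation.fiber_convergent_to_fst[OF product_presentation_swap])

end

section \<open>The dual ball of an \<open>\<ell>\<^sub>1\<close>-sum\<close>

text \<open>Packaged as a bounded operator, so that restricting a functional to a summand is
  composition with a fixed operator, which is norm continuous.\<close>

definition l1_inl :: "'a::real_normed_vector \<Rightarrow>\<^sub>L ('a, 'b::real_normed_vector) l1_sum" where
  "l1_inl = Blinfun (\<lambda>x. L1_Pair x 0)"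

definition l1_inr :: "'b::real_normed_vector \<Rightarrow>\<^sub>L ('a::real_normed_vector, 'b) l1_sum" where
  "l1_inr = Blinfun (\<lambda>y. L1_Pair 0 y)"

definition l1_proj1 :: "('a::real_normed_vector, 'b::real_normed_vector) l1_sum \<Rightarrow>\<^sub>L 'a" where
  "l1_proj1 = Blinfun l1_fst"

definition l1_proj2 :: "('a::real_normed_vector, 'b::real_normed_vector) l1_sum \<Rightarrow>\<^sub>L 'b" where
  "l1_proj2 = Blinfun l1_snd"

lemma l1_inl_apply [simp]: "blinfun_apply l1_inl x = L1_Pair x 0"
  unfolding l1_inl_def
  by (subst bounded_linear_Blinfun_apply)
    (auto intro!: bounded_linear_intro[of _ 1] simp: l1_sum_vector_defs norm_l1_sum_def)

lemma l1_inr_apply [simp]: "blinfun_apply l1_inr y = L1_Pair 0 y"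
  unfolding l1_inr_def
  by (subst bounded_linear_Blinfun_apply)
    (auto intro!: bounded_linear_intro[of _ 1] simp: l1_sum_vector_defs norm_l1_sum_def)

lemma l1_proj1_apply [simp]: "blinfun_apply l1_proj1 z = l1_fst z"
  unfolding l1_proj1_def
  by (subst bounded_linear_Blinfun_apply)
    (auto intro!: bounded_linear_intro[of _ 1] simp: norm_l1_sum_def)

lemma l1_proj2_apply [simp]: "blinfun_apply l1_proj2 z = l1_snd z"
  unfolding l1_proj2_def
  by (subst bounded_linear_Blinfun_apply)
    (auto intro!: bounded_linear_intro[of _ 1] simp: norm_l1_sum_def)

definition dual_fst :: "(('a::real_normed_vector, 'b::real_normed_vector) l1_sum \<Rightarrow>\<^sub>L real) \<Rightarrow> 'a \<Rightarrow>\<^sub>L real" where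
  "dual_fst \<phi> = \<phi> o\<^sub>L l1_inl"

definition dual_snd :: "(('a::real_normed_vector, 'b::real_normed_vector) l1_sum \<Rightarrow>\<^sub>L real) \<Rightarrow> 'b \<Rightarrow>\<^sub>L real" where
  "dual_snd \<phi> = \<phi> o\<^sub>L l1_inr"

text \<open>The inverse of the map sending a functional on the sum to its two restrictions.\<close>

definition dual_pair ::
    "('a::real_normed_vector \<Rightarrow>\<^sub>L real) \<Rightarrow> ('b::real_normed_vector \<Rightarrow>\<^sub>L real) \<Rightarrow> ('a, 'b) l1_sum \<Rightarrow>\<^sub>L real" where
  "dual_pair \<phi> \<psi> = (\<phi> o\<^sub>L l1_proj1) + (\<psi> o\<^sub>L l1_proj2)"

lemma dual_apply [simp]:
  "blinfun_apply (dual_fst \<rho>) x = blinfun_apply \<rho> (L1_Pair x 0)"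
  "blinfun_apply (dual_snd \<rho>) y = blinfun_apply \<rho> (L1_Pair 0 y)"
  "blinfun_apply (dual_pair \<phi> \<psi>) z = blinfun_apply \<phi> (l1_fst z) + blinfun_apply \<psi> (l1_snd z)"
  by (simp_all add: dual_fst_def dual_snd_def dual_pair_def blinfun.add_left)

lemma dual_pair_fst_snd: "dual_pair (dual_fst \<rho>) (dual_snd \<rho>) = \<rho>"
  by (rule blinfun_eqI) (simp add: l1_sum_vector_defs flip: blinfun.add_right)

lemma dual_fst_pair: "dual_fst (dual_pair \<phi> \<psi>) = \<phi>" and dual_snd_pair: "dual_snd (dual_pair \<phi> \<psi>) = \<psi>"
  by (rule blinfun_eqI, simp)+

lemma norm_dual_fst_le: "norm (dual_fst \<rho>) \<le> norm \<rho>"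
proof (rule norm_blinfun_bound)
  show "norm (blinfun_apply (dual_fst \<rho>) x) \<le> norm \<rho> * norm x" for x
    using norm_blinfun[of \<rho> "L1_Pair x 0"] by (simp add: norm_l1_sum_def)
qed simp

lemma topspace_dual_ball: "topspace dual_ball = cball 0 1"
  by (simp add: dual_ball_def strong_operator_topology_topspace)

lemma continuous_map_dual_ball_iff:
  "continuous_map T dual_ball f \<longleftrightarrow>
     (\<forall>x. continuous_map T euclidean (\<lambda>t. blinfun_apply (f t) x)) \<and> f ` topspace T \<subseteq> cball 0 1"
  by (auto simp: dual_ball_def continuous_map_in_subtopology continuous_on_strong_operator_topo_iff_coordinatewise)

lemma continuous_map_dual_ball_apply: "continuous_map dual_ball euclidean (\<lambda>\<phi>. blinfun_apply \<phi> x)"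
  unfolding dual_ball_def by (intro continuous_map_from_subtopology strong_operator_topology_continuous_evaluation)

lemma norm_dual_snd_le: "norm (dual_snd \<rho>) \<le> norm \<rho>"
proof (rule norm_blinfun_bound)
  show "norm (blinfun_apply (dual_snd \<rho>) y) \<le> norm \<rho> * norm y" for y
    using norm_blinfun[of \<rho> "L1_Pair 0 y"] by (simp add: norm_l1_sum_def)
qed simp

text \<open>The choice of the \<ell>1 norm enters here: \<open>c * norm x + c * norm y\<close> is
  exactly \<open>c\<close> times the norm of the pair. Hence any two functionals in the unit balls
  combine to one in the unit ball, and the dual ball is the full product.\<close>

lemma norm_dual_pair_le:
  assumes "norm \<phi> \<le> c" "norm \<psi> \<le> c"
  shows "norm (dual_pair \<phi> \<psi>) \<le> c"
proof (rule norm_blinfun_bound)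
  show "0 \<le> c" using assms(1) norm_ge_zero order_trans by blast
  fix z :: "('a, 'b) l1_sum"
  have "norm (blinfun_apply \<phi> (l1_fst z)) \<le> c * norm (l1_fst z)"
    using norm_blinfun[of \<phi> "l1_fst z"] mult_right_mono[OF assms(1) norm_ge_zero] order_trans by blast
  moreover have "norm (blinfun_apply \<psi> (l1_snd z)) \<le> c * norm (l1_snd z)"
    using norm_blinfun[of \<psi> "l1_snd z"] mult_right_mono[OF assms(2) norm_ge_zero] order_trans by blast
  ultimately show "norm (blinfun_apply (dual_pair \<phi> \<psi>) z) \<le> c * norm z"
    by (simp add: norm_l1_sum_def distrib_left)
qed

text \<open>Weak-star continuity is tested on evaluations: evaluating a restriction is evaluating at
  a vector of one summand, and evaluating \<open>dual_pair\<close> is a sum of one evaluation in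
  each factor.\<close>

lemma dual_ball_l1_sum_presentation:
  assumes "compact_space (dual_ball :: ('a::real_normed_vector \<Rightarrow>\<^sub>L real) topology)"
    and "Hausdorff_space (dual_ball :: ('a \<Rightarrow>\<^sub>L real) topology)"
    and "compact_space (dual_ball :: ('b::real_normed_vector \<Rightarrow>\<^sub>L real) topology)"
    and "Hausdorff_space (dual_ball :: ('b \<Rightarrow>\<^sub>L real) topology)"
  shows "product_presentation (dual_ball :: (('a, 'b) l1_sum \<Rightarrow>\<^sub>L real) topology)
    (dual_ball :: ('a \<Rightarrow>\<^sub>L real) topology) (dual_ball :: ('b \<Rightarrow>\<^sub>L real) topology) dual_fst dual_snd"
proof
  let ?M = "dual_ball :: (('a, 'b) l1_sum \<Rightarrow>\<^sub>L real) topology"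
  let ?K = "dual_ball :: ('a \<Rightarrow>\<^sub>L real) topology" and ?L = "dual_ball :: ('b \<Rightarrow>\<^sub>L real) topology"
  have "continuous_map ?M ?K dual_fst"
    unfolding continuous_map_dual_ball_iff
    by (auto simp: continuous_map_dual_ball_apply topspace_dual_ball intro: order_trans[OF norm_dual_fst_le])
  moreover have "continuous_map ?M ?L dual_snd"
    unfolding continuous_map_dual_ball_iff
    by (auto simp: continuous_map_dual_ball_apply topspace_dual_ball intro: order_trans[OF norm_dual_snd_le])
  moreover have "continuous_map (prod_topology ?K ?L) ?M (\<lambda>w. dual_pair (fst w) (snd w))"
    unfolding continuous_map_dual_ball_iff
  proof (intro conjI allI)
    fix z :: "('a, 'b) l1_sum"
    have "continuous_map (prod_topology ?K ?L) euclidean ((\<lambda>\<phi>. blinfun_apply \<phi> (l1_fst z)) \<circ> fst)"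
      "continuous_map (prod_topology ?K ?L) euclidean ((\<lambda>\<psi>. blinfun_apply \<psi> (l1_snd z)) \<circ> snd)"
      by (rule continuous_map_compose[OF continuous_map_fst continuous_map_dual_ball_apply]
          continuous_map_compose[OF continuous_map_snd continuous_map_dual_ball_apply])+
    from continuous_map_add[OF this]
    show "continuous_map (prod_topology ?K ?L) euclidean (\<lambda>w. blinfun_apply (dual_pair (fst w) (snd w)) z)"
      by (simp add: o_def)
    show "(\<lambda>w. dual_pair (fst w) (snd w)) ` topspace (prod_topology ?K ?L) \<subseteq> cball 0 1"
      by (auto simp: topspace_dual_ball intro: norm_dual_pair_le)
  qed
  ultimately have "homeomorphic_maps ?M (prod_topology ?K ?L)
      (\<lambda>\<rho>. (dual_fst \<rho>, dual_snd \<rho>)) (\<lambda>w. dual_pair (fst w) (snd w))"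
    by (auto simp: homeomorphic_maps_def continuous_map_pairwise o_def
        dual_pair_fst_snd dual_fst_pair dual_snd_pair)
  then show "homeomorphic_map ?M (prod_topology ?K ?L) (\<lambda>\<rho>. (dual_fst \<rho>, dual_snd \<rho>))"
    using homeomorphic_map_maps by blast
qed (use assms in \<open>simp_all add: topspace_dual_ball\<close>)

section \<open>Norm convergence and the class \<open>\<E>\<close>\<close>

text \<open>Restriction and recombination are built from sums and compositions with fixed bounded
  operators, so both preserve norm limits.\<close>

lemma convergent_dual_iff:
  "convergent \<rho>s \<longleftrightarrow> convergent (dual_fst \<circ> \<rho>s) \<and> convergent (dual_snd \<circ> \<rho>s)"
proof
  assume "convergent \<rho>s"
  then obtain \<rho> where "\<rho>s \<longlonglongrightarrow> \<rho>" by (auto simp: convergent_def)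
  then have "(dual_fst \<circ> \<rho>s) \<longlonglongrightarrow> dual_fst \<rho>" "(dual_snd \<circ> \<rho>s) \<longlonglongrightarrow> dual_snd \<rho>"
    unfolding dual_fst_def[abs_def] dual_snd_def[abs_def] o_def
    by (auto intro: bounded_bilinear.tendsto[OF bounded_bilinear_blinfun_compose])
  then show "convergent (dual_fst \<circ> \<rho>s) \<and> convergent (dual_snd \<circ> \<rho>s)" by (auto simp: convergent_def)
next
  assume "convergent (dual_fst \<circ> \<rho>s) \<and> convergent (dual_snd \<circ> \<rho>s)"
  then obtain \<phi> \<psi> where "(dual_fst \<circ> \<rho>s) \<longlonglongrightarrow> \<phi>" "(dual_snd \<circ> \<rho>s) \<longlonglongrightarrow> \<psi>" by (auto simp: convergent_def)
  then have "(\<lambda>n. dual_pair ((dual_fst \<circ> \<rho>s) n) ((dual_snd \<circ> \<rho>s) n)) \<longlonglongrightarrow> dual_pair \<phi> \<psi>"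
    unfolding dual_pair_def
    by (intro tendsto_add bounded_bilinear.tendsto[OF bounded_bilinear_blinfun_compose] tendsto_const)
  then show "convergent \<rho>s" by (auto simp: convergent_def dual_pair_fst_snd)
qed

text \<open>The constant sequence \<open>0\<close> converges in norm, hence is fiber convergent, and fiber convergence is only
  defined on compact Hausdorff spaces of uncountable weight; this spares the Banach--Alaoglu theorem.\<close>

lemma class_E_dual_ball:
  assumes "class_E TYPE('a::banach)"
  shows "compact_space (dual_ball :: ('a \<Rightarrow>\<^sub>L real) topology)"
    and "Hausdorff_space (dual_ball :: ('a \<Rightarrow>\<^sub>L real) topology)"
    and "\<not> second_countable (dual_ball :: ('a \<Rightarrow>\<^sub>L real) topology)"
proof -
  have "fiber_convergent dual_ball (\<lambda>_. 0 :: 'a \<Rightarrow>\<^sub>L real)"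
    using assms convergent_const[of "0 :: 'a \<Rightarrow>\<^sub>L real"] by (simp add: class_E_def image_subset_iff)
  then show "compact_space (dual_ball :: ('a \<Rightarrow>\<^sub>L real) topology)"
    "Hausdorff_space (dual_ball :: ('a \<Rightarrow>\<^sub>L real) topology)"
    "\<not> second_countable (dual_ball :: ('a \<Rightarrow>\<^sub>L real) topology)"
    by (auto simp: fiber_convergent_def fiber_convergent_to_def)
qed

theorem proposition19:
  assumes "class_E TYPE('a::banach)"
    and "class_E TYPE('b::banach)"
  shows "class_E TYPE(('a, 'b) l1_sum)"
  unfolding class_E_def
proof (intro conjI allI impI)
  \<comment> \<open>Separability passes to continuous images, and the first coordinate maps the sum
    onto the nonseparable first summand.\<close>
  have "continuous_map euclidean euclidean (l1_fst :: ('a, 'b) l1_sum \<Rightarrow> 'a)"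
    using linear_continuous_on[OF blinfun.bounded_linear_right[of "l1_proj1 :: ('a, 'b) l1_sum \<Rightarrow>\<^sub>L 'a"]]
    by simp
  moreover have "l1_fst ` topspace (euclidean :: ('a, 'b) l1_sum topology) = topspace euclidean"
    by (auto intro: image_eqI[of _ _ "L1_Pair _ 0"])
  ultimately show "\<not> separable_space (euclidean :: ('a, 'b) l1_sum topology)"
    using assms(1) separable_space_continuous_map_image unfolding class_E_def by blast
next
  fix \<rho>s :: "nat \<Rightarrow> ('a, 'b) l1_sum \<Rightarrow>\<^sub>L real"
  assume ball: "range \<rho>s \<subseteq> cball 0 1"
  note K = class_E_dual_ball[OF assms(1)] and L = class_E_dual_ball[OF assms(2)]
  interpret product_presentation "dual_ball :: (('a, 'b) l1_sum \<Rightarrow>\<^sub>L real) topology"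
    "dual_ball :: ('a \<Rightarrow>\<^sub>L real) topology" "dual_ball :: ('b \<Rightarrow>\<^sub>L real) topology" dual_fst dual_snd
    by (rule dual_ball_l1_sum_presentation[OF K(1,2) L(1,2)])
  have ball': "range (dual_fst \<circ> \<rho>s) \<subseteq> cball 0 1" "range (dual_snd \<circ> \<rho>s) \<subseteq> cball 0 1"
    using ball by (auto simp: image_subset_iff intro: order_trans[OF norm_dual_fst_le] order_trans[OF norm_dual_snd_le])
  have "fiber_convergent dual_ball \<rho>s \<longleftrightarrow>
      fiber_convergent dual_ball (dual_fst \<circ> \<rho>s) \<and> fiber_convergent dual_ball (dual_snd \<circ> \<rho>s)"
  proof
    assume "fiber_convergent dual_ball \<rho>s"
    then show "fiber_convergent dual_ball (dual_fst \<circ> \<rho>s) \<and> fiber_convergent dual_ball (dual_snd \<circ> \<rho>s)"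
      using fiber_convergent_to_fst K(3) fiber_convergent_to_snd L(3) unfolding fiber_convergent_def by blast
  next
    assume "fiber_convergent dual_ball (dual_fst \<circ> \<rho>s) \<and> fiber_convergent dual_ball (dual_snd \<circ> \<rho>s)"
    then obtain \<phi> \<psi> where lim: "fiber_convergent_to dual_ball (dual_fst \<circ> \<rho>s) \<phi>"
      "fiber_convergent_to dual_ball (dual_snd \<circ> \<rho>s) \<psi>"
      by (auto simp: fiber_convergent_def)
    then have "\<phi> \<in> topspace dual_ball" "\<psi> \<in> topspace dual_ball"
      by (auto simp: fiber_convergent_to_def dest: limitin_topspace)
    \<comment> \<open>The two coordinate limits are assembled into one functional of the dual ball,
      the limit to which \<open>fiber_convergent_to_pair\<close> applies.\<close>
    then obtain \<rho> where "\<rho> \<in> topspace dual_ball" "dual_fst \<rho> = \<phi>" "dual_snd \<rho> = \<psi>"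
      by (rule pair_surj)
    then have "fiber_convergent_to dual_ball \<rho>s \<rho>"
      using lim ball by (intro fiber_convergent_to_pair) (simp_all add: topspace_dual_ball)
    then show "fiber_convergent dual_ball \<rho>s" by (auto simp: fiber_convergent_def)
  qed
  also have "\<dots> \<longleftrightarrow> convergent (dual_fst \<circ> \<rho>s) \<and> convergent (dual_snd \<circ> \<rho>s)"
    using assms ball' by (simp add: class_E_def)
  also have "\<dots> \<longleftrightarrow> convergent \<rho>s" by (rule convergent_dual_iff[symmetric])
  finally show "fiber_convergent dual_ball \<rho>s \<longleftrightarrow> convergent \<rho>s" .
qed

end
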